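(* Let $\rho=(r_n)_n$ be an increasing sequence in $[0,1)$ with $r_n\to 1$ as $n\to\infty$. (1) For any $f\in\mathcal{U}_A(\mathbb{D},\rho)$ and any non-constant holomorphic function $g: f(\mathbb{D})\to\mathbb{C}$, the composition $g\circ f$ belongs to $\mathcal{U}_A(\mathbb{D},\rho)$. (2) Let $\Phi:\mathbb{D}\to\mathbb{D}$ be holomorphic on $\mathbb{D}$ and continuous on $\overline{\mathbb{D}}$ (i.e. $\Phi$ extends continuously to $\overline{\mathbb{D}}$). Then $f\circ\Phi$ belongs to $\mathcal{U}_A(\mathbb{D},\rho)$ for every $f\in\mathcal{U}_A(\mathbb{D},\rho)$ if and only if $\Phi$ is a rotation, that is, $\Phi(z)=e^{i\theta}z$ for some $\theta\in[0,2\pi]$.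
   Context: $\mathbb{D}=\{z\in\mathbb{C}:|z|<1\}$ is the open unit disc, $\mathbb{T}=\partial\mathbb{D}$ the unit circle, and $H(\mathbb{D})$ the space of holomorphic functions on $\mathbb{D}$. For an increasing sequence $\rho=(r_n)_n$ in $[0,1)$ with $r_n\to1$, $\mathcal{U}_A(\mathbb{D},\rho)$ denotes the set of all $f\in H(\mathbb{D})$ such that: for any compact subset $K\subset\mathbb{T}$, $K\neq\mathbb{T}$, and any continuous function $\varphi:K\to\mathbb{C}$, there exists an increasing sequence $(n_k)_k$ in $\mathbb{N}$ such that $\sup_{\zeta\in K}|f(r_{n_k}\zeta)-\varphi(\zeta)|\to0$ as $k\to\infty$. *)

theory Defs
  imports "HOL-Complex_Analysis.Complex_Analysis"
begin

text \<open>
  Holomorphic functions on the unit disc are represented by total functions on the complex plane;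
  membership below depends only on the values of \<open>f\<close> on \<open>ball 0 1\<close> as soon as every \<open>\<rho> n\<close> lies in
  \<open>{0..<1}\<close>. The subsequence indexed by \<open>n\<close> is strictly increasing, and the condition
  \<open>sup\<^sub>\<zeta> |f (\<rho> (n k) \<zeta>) - \<phi> \<zeta>| \<longlonglongrightarrow> 0\<close> over \<open>\<zeta> \<in> K\<close> is uniform convergence on \<open>K\<close>.
\<close>

definition abel_universal :: "(nat \<Rightarrow> real) \<Rightarrow> (complex \<Rightarrow> complex) set"
  where "abel_universal \<rho> =
    {f. f holomorphic_on ball 0 1 \<and>
        (\<forall>K \<phi>. compact K \<and> K \<subseteq> sphere 0 1 \<and> K \<noteq> sphere 0 1 \<and> continuous_on K \<phi> \<longrightarrow>
          (\<exists>n :: nat \<Rightarrow> nat. strict_mono n \<and>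
            uniform_limit K (\<lambda>k \<zeta>. f (complex_of_real (\<rho> (n k)) * \<zeta>)) \<phi> sequentially))}"

end

theory Submission
  imports Defs "HOL-Computational_Algebra.Fundamental_Theorem_Algebra"
begin

text \<open>
  Part (1) is a path lifting problem for \<open>g\<close>: a continuous function on a proper compact subset of
  the circle is, after extension to an arc, a path, and it has to be approximated by \<open>g \<circ> \<psi>\<close> for a
  path \<open>\<psi>\<close> in \<open>f(D)\<close>. Such liftings exist up to a small error because \<open>f(D)\<close> is parabolic: as
  \<open>f(r\<^sub>n \<zeta>)\<close> is almost constant off a short arc, bounded subharmonic functions on \<open>f(D)\<close> are
  constant, and so \<open>g\<close> has the Iversen property.

  In part (2), \<open>\<Phi>\<close> must be unimodular on the circle, since otherwise \<open>f(\<Phi>(r\<^sub>n \<zeta>))\<close> converges for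
  some \<open>\<zeta>\<close>. If for some \<open>\<zeta>\<close> the points \<open>\<Phi>(r\<^sub>n \<zeta>)\<close> avoid all the circles \<open>\<bar>z\<bar> = r\<^sub>m\<close>, then Runge
  approximation gives a universal \<open>f\<close> bounded on these points. Otherwise uncountably many \<open>\<zeta>\<close> share
  one pair \<open>(n, m)\<close> with \<open>\<bar>\<Phi>(r\<^sub>n \<zeta>)\<bar> = r\<^sub>m\<close>. Then \<open>\<bar>\<Phi>\<bar>\<close> is constant on a circle, and repeated reflection
  leaves \<open>0\<close> as the only possible zero, so \<open>\<Phi>(z) = c z\<^sup>d\<close>; a set \<open>K\<close> of two points with the same
  \<open>d\<close>-th power excludes \<open>d > 1\<close>.
\<close>

section \<open>Uniform approximation by polynomials\<close>

text \<open>Exact lifting through \<open>g\<close> is impossible in general: \<open>g\<close> may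
  omit values of the given path, have critical points or asymptotic values, and a lift may run to
  the boundary of \<open>f(D)\<close>. So paths are lifted only approximately, by corrections along
  which \<open>g\<close> stays in a prescribed disc. In the construction of universal functions the
  obstacle is a disconnected complement: a disc, an arc of one larger circle and finitely many
  further points admit polynomial approximation of unrelated data, a disc with a full larger circle
  does not. Values at points off the circles |z| = r_m can therefore be corrected stage by stage,
  provided that only finitely many of them lie in each smaller disc, while points on these circles
  may be claimed by the arc. This is why part (2) turns on coincidences of moduli. Each reflection
  squares the radius of the circle, and from the first one on the modulus is known on the entire
  circle, not merely on an infinite subset.\<close>

definition poly_approx :: "complex set \<Rightarrow> (complex \<Rightarrow> complex) \<Rightarrow> bool" where
  "poly_approx L u \<longleftrightarrow> (\<forall>e>0. \<exists>p. \<forall>z\<in>L. cmod (u z - poly p z) < e)"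

lemma poly_approxD:
  assumes "poly_approx L u" "e > 0"
  obtains p where "\<And>z. z \<in> L \<Longrightarrow> cmod (u z - poly p z) < e"
  using assms unfolding poly_approx_def by blast

lemma poly_approx_poly: "poly_approx L (poly p)"
  unfolding poly_approx_def by (intro allI impI exI[of _ p]) simp

lemma poly_approx_const: "poly_approx L (\<lambda>z. c)"
  unfolding poly_approx_def by (intro allI impI exI[of _ "[:c:]"]) simp

lemma poly_approx_cong:
  assumes "poly_approx L u" "\<And>z. z \<in> L \<Longrightarrow> u z = v z"
  shows "poly_approx L v"
  using assms unfolding poly_approx_def by simp

lemma poly_approx_add:
  assumes "poly_approx L u" "poly_approx L v"
  shows "poly_approx L (\<lambda>z. u z + v z)"
  unfolding poly_approx_def
proof (intro allI impI)
  fix e :: real assume "e > 0"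
  then have "e/2 > 0" by simp
  obtain p where p: "\<And>z. z \<in> L \<Longrightarrow> cmod (u z - poly p z) < e/2"
    using poly_approxD[OF assms(1) \<open>e/2 > 0\<close>] by blast
  obtain q where q: "\<And>z. z \<in> L \<Longrightarrow> cmod (v z - poly q z) < e/2"
    using poly_approxD[OF assms(2) \<open>e/2 > 0\<close>] by blast
  have "cmod (u z + v z - poly (p + q) z) < e" if "z \<in> L" for z
    using norm_triangle_ineq[of "u z - poly p z" "v z - poly q z"] p[OF that] q[OF that]
    by (simp add: algebra_simps)
  then show "\<exists>p. \<forall>z\<in>L. cmod (u z + v z - poly p z) < e" by blast
qed

lemma poly_approx_limit:
  assumes "\<And>e. e > 0 \<Longrightarrow> \<exists>v. poly_approx L v \<and> (\<forall>z\<in>L. cmod (u z - v z) < e)"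
  shows "poly_approx L u"
  unfolding poly_approx_def
proof (intro allI impI)
  fix e :: real assume "e > 0"
  then have e2: "e/2 > 0" by simp
  then obtain v where v: "poly_approx L v" "\<And>z. z \<in> L \<Longrightarrow> cmod (u z - v z) < e/2"
    using assms by blast
  obtain p where p: "\<And>z. z \<in> L \<Longrightarrow> cmod (v z - poly p z) < e/2"
    using poly_approxD[OF v(1) e2] by blast
  have "cmod (u z - poly p z) < e" if "z \<in> L" for z
    using norm_triangle_ineq[of "u z - v z" "v z - poly p z"] p[OF that] v(2)[OF that] by simp
  then show "\<exists>p. \<forall>z\<in>L. cmod (u z - poly p z) < e" by blast
qed

lemma poly_bounded_on_compact:
  assumes "compact L"
  obtains B where "B > 0" "\<And>z. z \<in> L \<Longrightarrow> cmod (poly p z) < B"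
proof -
  have "bounded (poly p ` L)"
    by (intro compact_imp_bounded compact_continuous_image assms continuous_intros)
  then obtain B where "B > 0" "\<forall>x\<in>poly p ` L. cmod x \<le> B" using bounded_pos by blast
  then show ?thesis by (intro that[of "B + 1"]) force+
qed

lemma poly_approx_bounded:
  assumes "poly_approx L u" "compact L"
  obtains B where "B > 0" "\<And>z. z \<in> L \<Longrightarrow> cmod (u z) < B"
proof -
  obtain p where p: "\<And>z. z \<in> L \<Longrightarrow> cmod (u z - poly p z) < 1"
    using poly_approxD[OF assms(1), of 1] by auto
  obtain B where B: "B > 0" "\<And>z. z \<in> L \<Longrightarrow> cmod (poly p z) < B"
    using poly_bounded_on_compact[OF assms(2)] by blast
  have "cmod (u z) < B + 1" if "z \<in> L" for z
    using norm_triangle_ineq[of "u z - poly p z" "poly p z"] p[OF that] B(2)[OF that] by simp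
  then show ?thesis using B(1) by (intro that[of "B + 1"]) auto
qed

text \<open>Separated from the general product so that each of the two replacements there needs a
  bound for only one fixed factor.\<close>

lemma poly_approx_mult_poly:
  assumes "poly_approx L u" "compact L"
  shows "poly_approx L (\<lambda>z. u z * poly q z)"
  unfolding poly_approx_def
proof (intro allI impI)
  fix e :: real assume "e > 0"
  obtain B where B: "B > 0" "\<And>z. z \<in> L \<Longrightarrow> cmod (poly q z) < B"
    using poly_bounded_on_compact[OF assms(2)] by blast
  have "e / B > 0" using \<open>e > 0\<close> B by simp
  obtain p where p: "\<And>z. z \<in> L \<Longrightarrow> cmod (u z - poly p z) < e / B"
    using poly_approxD[OF assms(1) \<open>e / B > 0\<close>] by blast
  have "cmod (u z * poly q z - poly (p * q) z) < e" if "z \<in> L" for z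
  proof -
    have "cmod (u z * poly q z - poly (p * q) z) = cmod (u z - poly p z) * cmod (poly q z)"
      by (simp add: norm_mult[symmetric] algebra_simps)
    also have "\<dots> < (e / B) * B"
      using p[OF that] B(2)[OF that] B(1) by (intro mult_strict_mono') auto
    finally show ?thesis using B(1) by simp
  qed
  then show "\<exists>p. \<forall>z\<in>L. cmod (u z * poly q z - poly p z) < e" by blast
qed

lemma poly_approx_mult:
  assumes "poly_approx L u" "poly_approx L v" "compact L"
  shows "poly_approx L (\<lambda>z. u z * v z)"
proof (rule poly_approx_limit)
  fix e :: real assume "e > 0"
  obtain B where B: "B > 0" "\<And>z. z \<in> L \<Longrightarrow> cmod (u z) < B"
    using poly_approx_bounded[OF assms(1,3)] by blast
  have "e / B > 0" using \<open>e > 0\<close> B by simp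
  obtain q where q: "\<And>z. z \<in> L \<Longrightarrow> cmod (v z - poly q z) < e / B"
    using poly_approxD[OF assms(2) \<open>e / B > 0\<close>] by blast
  have "cmod (u z * v z - u z * poly q z) < e" if "z \<in> L" for z
  proof -
    have "cmod (u z * v z - u z * poly q z) = cmod (u z) * cmod (v z - poly q z)"
      by (simp add: norm_mult[symmetric] algebra_simps)
    also have "\<dots> < B * (e / B)"
      using q[OF that] B(2)[OF that] B(1) by (intro mult_strict_mono') auto
    finally show ?thesis using B(1) by simp
  qed
  then show "\<exists>w. poly_approx L w \<and> (\<forall>z\<in>L. cmod (u z * v z - w z) < e)"
    using poly_approx_mult_poly[OF assms(1,3), of q] by blast
qed

lemma poly_approx_power:
  assumes "poly_approx L u" "compact L"
  shows "poly_approx L (\<lambda>z. u z ^ n)"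
  by (induction n) (use assms in \<open>auto intro: poly_approx_const poly_approx_mult\<close>)

lemma poly_approx_sum:
  assumes "finite I" "\<And>i. i \<in> I \<Longrightarrow> poly_approx L (u i)"
  shows "poly_approx L (\<lambda>z. \<Sum>i\<in>I. u i z)"
  using assms by (induction I rule: finite_induct) (auto intro: poly_approx_const poly_approx_add)

text \<open>
  Moving a pole: \<open>1 / (z - b)\<close> is the sum of a series in powers of \<open>1 / (z - a)\<close> converging
  uniformly on \<open>L\<close> as soon as \<open>\<bar>b - a\<bar>\<close> is smaller than the distance from \<open>a\<close> to \<open>L\<close>.
\<close>
lemma poly_approx_push_pole:
  assumes a: "poly_approx L (\<lambda>z. 1 / (z - a))" and "compact L"
    and d: "\<And>z. z \<in> L \<Longrightarrow> d \<le> cmod (z - a)" and b: "cmod (b - a) < d"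
  shows "poly_approx L (\<lambda>z. 1 / (z - b))"
proof (rule poly_approx_limit)
  fix e :: real assume "e > 0"
  have dpos: "d > 0" using b norm_ge_zero[of "b - a"] by linarith
  define t where "t = cmod (b - a) / d"
  have t: "0 \<le> t" "t < 1" using b dpos by (auto simp: t_def)
  have "(\<lambda>n. t ^ n / (d - cmod (b - a))) \<longlonglongrightarrow> 0 / (d - cmod (b - a))"
    using t b by (intro tendsto_intros LIMSEQ_realpow_zero) auto
  then have "\<forall>\<^sub>F n in sequentially. t ^ n / (d - cmod (b - a)) < e"
    using \<open>e > 0\<close> by (auto dest: order_tendstoD(2))
  then obtain n where n: "t ^ n / (d - cmod (b - a)) < e"
    using eventually_happens by force
  define v where "v = (\<lambda>z. \<Sum>i<n. ((b - a) * (1 / (z - a))) ^ i * (1 / (z - a)))"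
  have "poly_approx L v" unfolding v_def
    by (intro poly_approx_sum poly_approx_mult poly_approx_power poly_approx_const a assms) auto
  moreover have "cmod (1 / (z - b) - v z) < e" if "z \<in> L" for z
  proof -
    define x where "x = (b - a) / (z - a)"
    have za: "cmod (z - a) \<ge> d" "z \<noteq> a" using d[OF that] dpos by auto
    have xt: "cmod x \<le> t" unfolding x_def t_def norm_divide
      using za dpos by (intro divide_left_mono) auto
    have zb: "cmod (z - b) \<ge> d - cmod (b - a)"
      using za norm_triangle_ineq2[of "z - a" "b - a"] by simp
    have zb0: "z \<noteq> b" using zb b by auto
    have x1: "x \<noteq> 1" using xt t by auto
    have "v z = (\<Sum>i<n. x ^ i) * (1 / (z - a))"
      by (simp only: v_def x_def sum_distrib_right) simp
    also have "\<dots> = (1 - x ^ n) / ((1 - x) * (z - a))"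
      using x1 by (simp add: sum_gp_strict)
    also have "(1 - x) * (z - a) = z - b" using za by (simp add: x_def field_simps)
    finally have "1 / (z - b) - v z = x ^ n / (z - b)"
      using zb0 by (simp add: field_simps)
    then have "cmod (1 / (z - b) - v z) = cmod x ^ n / cmod (z - b)"
      by (simp add: norm_divide norm_power)
    also have "\<dots> \<le> t ^ n / (d - cmod (b - a))"
      using xt zb b t by (intro frac_le power_mono) auto
    finally show ?thesis using n by simp
  qed
  ultimately show "\<exists>v. poly_approx L v \<and> (\<forall>z\<in>L. cmod (1 / (z - b) - v z) < e)" by blast
qed

text \<open>For a pole outside a disc containing \<open>L\<close> the geometric series in
  \<open>z / a\<close> consists of polynomials and converges uniformly on \<open>L\<close>. This is
  where the moving of poles starts.\<close>

lemma poly_approx_far_pole: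
  assumes B: "\<And>z. z \<in> L \<Longrightarrow> cmod z \<le> B" and "B > 0" and a: "cmod a > B"
  shows "poly_approx L (\<lambda>z. 1 / (z - a))"
proof (rule poly_approx_limit)
  fix e :: real assume "e > 0"
  define t where "t = B / cmod a"
  have t: "0 \<le> t" "t < 1"
    using assms(2,3) by (auto simp: t_def divide_less_eq)
  have "(\<lambda>n. t ^ n / (cmod a - B)) \<longlonglongrightarrow> 0 / (cmod a - B)"
    using t a by (intro tendsto_intros LIMSEQ_realpow_zero) auto
  then have "\<forall>\<^sub>F n in sequentially. t ^ n / (cmod a - B) < e"
    using \<open>e > 0\<close> by (auto dest: order_tendstoD(2))
  then obtain n where n: "t ^ n / (cmod a - B) < e"
    using eventually_happens by force
  have a0: "a \<noteq> 0" using a \<open>B > 0\<close> by auto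
  define p where "p = [:- 1 / a:] * (\<Sum>i<n. [:0, 1 / a:] ^ i)"
  have "cmod (1 / (z - a) - poly p z) < e" if "z \<in> L" for z
  proof -
    define x where "x = z / a"
    have xt: "cmod x \<le> t" unfolding x_def t_def norm_divide
      using B[OF that] by (intro divide_right_mono) auto
    have zb: "cmod (z - a) \<ge> cmod a - B"
      using B[OF that] norm_triangle_ineq2[of a z] by (simp add: norm_minus_commute)
    have za: "z \<noteq> a" using zb a by auto
    have x1: "x \<noteq> 1" using xt t by auto
    have "poly p z = (\<Sum>i<n. x ^ i) * (- 1 / a)"
      by (simp add: p_def x_def poly_sum)
    also have "\<dots> = (1 - x ^ n) / ((1 - x) * (- a))"
      using x1 by (simp add: sum_gp_strict)
    also have "(1 - x) * (- a) = z - a" using a0 by (simp add: x_def field_simps)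
    finally have "1 / (z - a) - poly p z = x ^ n / (z - a)"
      using za by (simp add: field_simps)
    then have "cmod (1 / (z - a) - poly p z) = cmod x ^ n / cmod (z - a)"
      by (simp add: norm_divide norm_power)
    also have "\<dots> \<le> t ^ n / (cmod a - B)"
      using xt zb a t by (intro frac_le power_mono) auto
    finally show ?thesis using n by simp
  qed
  then show "\<exists>v. poly_approx L v \<and> (\<forall>z\<in>L. cmod (1 / (z - a) - v z) < e)"
    using poly_approx_poly[of L p] by blast
qed

text \<open>The admissible poles \<open>W\<close> contain all far points, and both \<open>W\<close>
  and its complement in \<open>- L\<close> are open because poles can be moved; connectedness of
  \<open>- L\<close> leaves nothing outside \<open>W\<close>.\<close>

theorem poly_approx_pole:
  assumes L: "compact L" and conn: "connected (- L)" and a: "a \<notin> L"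
  shows "poly_approx L (\<lambda>z. 1 / (z - a))"
proof -
  define W where "W = {a. a \<notin> L \<and> poly_approx L (\<lambda>z. 1 / (z - a))}"
  have cl: "closed L" using L by (rule compact_imp_closed)
  have gap: "\<exists>d>0. ball x d \<subseteq> - L" if "x \<notin> L" for x
    using that cl openE[of "- L" x] by (auto simp: open_Compl)
  have near: "b \<in> W" if "a \<in> W" "d > 0" "ball a d \<subseteq> - L" "b \<in> ball a d" for a b d
  proof -
    have "poly_approx L (\<lambda>z. 1 / (z - b))"
    proof (rule poly_approx_push_pole)
      show "poly_approx L (\<lambda>z. 1 / (z - a))" using that by (simp add: W_def)
      show "d \<le> cmod (z - a)" if "z \<in> L" for z
        using that \<open>ball a d \<subseteq> - L\<close> by (force simp: dist_norm norm_minus_commute)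
      show "cmod (b - a) < d" using that by (simp add: dist_norm norm_minus_commute)
    qed (use L in auto)
    then show ?thesis using that by (auto simp: W_def)
  qed
  have "open W"
    unfolding open_contains_ball
  proof
    fix x assume x: "x \<in> W"
    then obtain d where "d > 0" "ball x d \<subseteq> - L" using gap[of x] by (auto simp: W_def)
    then show "\<exists>e>0. ball x e \<subseteq> W" using near[OF x] by blast
  qed
  have "open (- L - W)"
    unfolding open_contains_ball
  proof
    fix x assume x: "x \<in> - L - W"
    then obtain d where d: "d > 0" "ball x d \<subseteq> - L" using gap[of x] by auto
    \<comment> \<open>With half the radius the ball about \<open>y\<close> still avoids
      \<open>L\<close> and contains \<open>x\<close>, so a pole at \<open>y\<close> could be moved
      back to \<open>x\<close>.\<close>
    have "y \<notin> W" if y: "y \<in> ball x (d/2)" for y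
    proof
      assume "y \<in> W"
      have "ball y (d/2) \<subseteq> ball x d"
      proof
        fix w assume "w \<in> ball y (d/2)"
        then show "w \<in> ball x d" using y dist_triangle[of x w y] by simp
      qed
      then have "x \<in> W"
        using near[OF \<open>y \<in> W\<close>, of "d/2" x] d y by (simp add: dist_commute)
      then show False using x by simp
    qed
    moreover have "ball x (d/2) \<subseteq> - L" using d subset_ball[of "d/2" d x] by auto
    ultimately show "\<exists>e>0. ball x e \<subseteq> - L - W"
      using d(1) by (intro exI[of _ "d/2"]) auto
  qed
  moreover have "W \<noteq> {}"
  proof -
    obtain B where B: "B > 0" "\<And>z. z \<in> L \<Longrightarrow> cmod z \<le> B"
      using compact_imp_bounded[OF L] bounded_pos by blast
    have "of_real (B + 1) \<in> W"
    proof -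
      have far: "cmod (of_real (B + 1)) > B" using B(1) by (simp only: norm_of_real)
      then have "of_real (B + 1) \<notin> L" using B(2) by force
      then show ?thesis using poly_approx_far_pole[OF B(2) B(1) far] by (simp add: W_def)
    qed
    then show ?thesis by blast
  qed
  ultimately have "- L - W = {}"
    using connectedD[OF conn \<open>open W\<close> \<open>open (- L - W)\<close>] by (auto simp: W_def)
  then show ?thesis using a by (auto simp: W_def)
qed

text \<open>All zeros of \<open>q\<close> lie off \<open>L\<close>, so \<open>1 / q\<close> is, up
  to a constant, a product of simple poles; one linear factor is split off per step.\<close>

lemma poly_approx_inverse_poly:
  assumes "compact L" "connected (- L)" "\<And>z. z \<in> L \<Longrightarrow> poly q z \<noteq> 0" "q \<noteq> 0"
  shows "poly_approx L (\<lambda>z. 1 / poly q z)"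
  using assms(3,4)
proof (induction "degree q" arbitrary: q)
  case 0
  then obtain c where "q = [:c:]" by (metis degree_eq_zeroE)
  then show ?case by (simp add: poly_approx_const)
next
  case (Suc n)
  have "\<not> constant (poly q)" using Suc(2) by (simp add: constant_degree)
  then obtain a where a: "poly q a = 0" using fundamental_theorem_of_algebra by blast
  then obtain r where r: "q = [:- a, 1:] * r" using poly_eq_0_iff_dvd dvdE by metis
  have r0: "r \<noteq> 0" using r Suc by auto
  have "degree q = Suc (degree r)" unfolding r using r0 by (subst degree_mult_eq) auto
  then have "poly_approx L (\<lambda>z. 1 / poly r z)"
    using Suc r r0 by (intro Suc.hyps(1)) auto
  moreover have "poly_approx L (\<lambda>z. 1 / (z - a))"
    using assms(1,2) a Suc.prems(1) by (intro poly_approx_pole) auto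
  ultimately have "poly_approx L (\<lambda>z. 1 / (z - a) * (1 / poly r z))"
    using assms(1) by (intro poly_approx_mult)
  then show ?case by (rule poly_approx_cong) (simp add: r field_simps)
qed

section \<open>Approximation on a disc, an arc and finitely many points\<close>

lemma sphere_subset_closure_annulus:
  fixes s r :: real
  assumes "s < r" "r > 0"
  shows "sphere (0::complex) r \<subseteq> closure {z. s < cmod z \<and> cmod z < r}"
proof
  fix z :: complex assume z: "z \<in> sphere 0 r"
  show "z \<in> closure {z. s < cmod z \<and> cmod z < r}"
    unfolding closure_approachable
  proof (intro allI impI)
    fix e :: real assume "e > 0"
    define m where "m = max s (max 0 (r - e))"
    define u where "u = (m + r) / 2"
    have u: "u < r" "s < u" "0 < u" "r - e < u"
      using assms \<open>e > 0\<close> by (auto simp: u_def m_def max_def)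
    have "cmod (of_real (u / r) * z) = u" using z u assms(2) unfolding norm_mult norm_of_real by simp
    moreover have "dist (of_real (u / r) * z) z < e"
    proof -
      have "dist (of_real (u / r) * z) z = cmod (of_real (u / r - 1) * z)"
        by (simp add: dist_norm algebra_simps)
      also have "\<dots> = \<bar>u / r - 1\<bar> * r" using z unfolding norm_mult norm_of_real by simp
      also have "\<dots> = r - u" using u assms(2) by (simp add: abs_if field_simps)
      finally show ?thesis using u by simp
    qed
    ultimately show "\<exists>y\<in>{z. s < cmod z \<and> cmod z < r}. dist y z < e"
      using u by (intro bexI[of _ "of_real (u / r) * z"]) auto
  qed
qed

lemma sphere_subset_closure_exterior:
  fixes r :: real
  assumes "r > 0"
  shows "sphere (0::complex) r \<subseteq> closure {z. r < cmod z}"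
proof
  fix z :: complex assume z: "z \<in> sphere 0 r"
  show "z \<in> closure {z. r < cmod z}"
    unfolding closure_approachable
  proof (intro allI impI)
    fix e :: real assume "e > 0"
    define u where "u = r + e / 2"
    have u: "r < u" "u < r + e" using assms \<open>e > 0\<close> by (auto simp: u_def)
    have "cmod (of_real (u / r) * z) = u" using z u assms unfolding norm_mult norm_of_real by simp
    moreover have "dist (of_real (u / r) * z) z < e"
    proof -
      have "dist (of_real (u / r) * z) z = cmod (of_real (u / r - 1) * z)"
        by (simp add: dist_norm algebra_simps)
      also have "\<dots> = \<bar>u / r - 1\<bar> * r" using z unfolding norm_mult norm_of_real by simp
      also have "\<dots> = u - r" using u assms by (simp add: abs_if field_simps)
      finally show ?thesis using u by simp
    qed
    ultimately show "\<exists>y\<in>{z. r < cmod z}. dist y z < e"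
      using u by (intro bexI[of _ "of_real (u / r) * z"]) auto
  qed
qed

text \<open>The gap \<open>G\<close> in the circle lies in the closure of the inner annulus and of
  the exterior, so it glues these two connected sets together. A negative \<open>s\<close> is
  allowed: the disc is then empty, which gives the complement of the arc alone.\<close>

lemma connected_compl_disc_arc:
  fixes s r :: real and c :: complex
  assumes "s < r" "r > 0" "cmod c = r" "d > 0"
  shows "connected (- (cball 0 s \<union> (sphere 0 r - ball c d)))"
proof -
  define G where "G = sphere 0 r \<inter> ball c d"
  define A where "A = {z::complex. s < cmod z \<and> cmod z < r}"
  define E where "E = {z::complex. r < cmod z}"
  have "connected A" unfolding A_def
    using connected_annulus(1)[of s "0::complex" r] by simp
  moreover have "G \<subseteq> closure A"
    using sphere_subset_closure_annulus[OF assms(1,2)] unfolding G_def A_def by blast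
  ultimately have 1: "connected (A \<union> G)"
    using connected_intermediate_closure[of A "A \<union> G"] closure_subset[of A] by simp
  have "E = - cball 0 r" by (auto simp: E_def)
  moreover have "connected (- cball (0::complex) r)"
    by (rule connected_complement_bounded_convex) auto
  ultimately have "connected E" by simp
  moreover have "G \<subseteq> closure E"
    using sphere_subset_closure_exterior[OF assms(2)] unfolding G_def E_def by blast
  ultimately have 2: "connected (E \<union> G)"
    using connected_intermediate_closure[of E "E \<union> G"] closure_subset[of E] by simp
  have "c \<in> (A \<union> G) \<inter> (E \<union> G)" using assms by (simp add: G_def)
  then have "connected ((A \<union> G) \<union> (E \<union> G))" using 1 2 connected_Un by blast
  also have "(A \<union> G) \<union> (E \<union> G) = - (cball 0 s \<union> (sphere 0 r - ball c d))"
    using assms(1) by (auto simp: A_def E_def G_def)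
  finally show ?thesis .
qed

text \<open>On a circle about the origin \<open>cnj z = r\<^sup>2 / z\<close>, and \<open>1 / z\<close> is a limit of polynomials on an arc.\<close>
lemma poly_approx_arc_cnj:
  assumes K: "compact K" "connected (- K)" "K \<subseteq> sphere 0 r" and "r > 0"
  shows "poly_approx K cnj"
proof -
  have "poly_approx K (\<lambda>z. of_real (r\<^sup>2) * (1 / (z - 0)))"
    using assms by (intro poly_approx_mult poly_approx_const poly_approx_pole) auto
  moreover have "of_real (r\<^sup>2) * (1 / (z - 0)) = cnj z" if "z \<in> K" for z
  proof -
    have "cmod z = r" "z \<noteq> 0" using that assms by auto
    then show ?thesis using complex_norm_square[of z] by (simp add: divide_eq_eq mult.commute)
  qed
  ultimately show ?thesis by (rule poly_approx_cong)
qed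

lemma poly_approx_arc_real_polynomial:
  assumes K: "compact K" "connected (- K)" "K \<subseteq> sphere 0 r" and "r > 0"
    and "real_polynomial_function u"
  shows "poly_approx K (\<lambda>z. complex_of_real (u z))"
  using assms(5)
proof induction
  case (linear f)
  then interpret f: bounded_linear f .
  have "poly_approx K (poly [:0, 1:])" by (rule poly_approx_poly)
  then have id: "poly_approx K (\<lambda>z. z)" by (rule poly_approx_cong) simp
  \<comment> \<open>The coefficients below come from inserting Re z = (z + cnj z) / 2 and Im z = (z
    - cnj z) / (2 i) into Re z * f(1) + Im z * f(i).\<close>
  define a where "a = complex_of_real (f 1)"
  define b where "b = complex_of_real (f \<i>)"
  have "poly_approx K (\<lambda>z. (a / 2 - \<i> * b / 2) * z + (a / 2 + \<i> * b / 2) * cnj z)"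
    using assms by (intro poly_approx_add poly_approx_mult poly_approx_const id
        poly_approx_arc_cnj[where r = r])
  moreover have "(a / 2 - \<i> * b / 2) * z + (a / 2 + \<i> * b / 2) * cnj z
      = complex_of_real (f z)" for z
  proof -
    have "z = Re z *\<^sub>R 1 + Im z *\<^sub>R \<i>" by (simp add: complex_eq_iff)
    then have "f z = Re z * f 1 + Im z * f \<i>"
      by (metis f.add f.scaleR real_scaleR_def)
    then show ?thesis by (simp add: a_def b_def complex_eq_iff algebra_simps)
  qed
  ultimately show ?case by simp
next
  case (const c)
  then show ?case by (simp add: poly_approx_const)
next
  case (add f g)
  then show ?case by (simp add: poly_approx_add)
next
  case (mult f g)
  then show ?case using K by (simp add: poly_approx_mult)
qed

text \<open>Stone-Weierstrass yields real polynomials in the two coordinates; on \<open>K\<close>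
  these are limits of complex polynomials because \<open>cnj\<close> is. A set with connected
  complement on a circle has no interior, so continuity of \<open>\<phi>\<close> suffices.\<close>

lemma poly_approx_arc:
  assumes K: "compact K" "connected (- K)" "K \<subseteq> sphere 0 r" and "r > 0"
    and cont: "continuous_on K \<phi>"
  shows "poly_approx K \<phi>"
proof (rule poly_approx_limit)
  fix e :: real assume "e > 0"
  then obtain g where g: "polynomial_function g" "\<And>z. z \<in> K \<Longrightarrow> cmod (\<phi> z - g z) < e"
    using Stone_Weierstrass_polynomial_function[OF K(1) cont \<open>e > 0\<close>] by (elim exE conjE) simp
  have "real_polynomial_function (\<lambda>z. Re (g z))" "real_polynomial_function (\<lambda>z. Im (g z))"
    using g(1) bounded_linear_Re bounded_linear_Im
    by (auto simp: polynomial_function_def o_def)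
  then have "poly_approx K (\<lambda>z. complex_of_real (Re (g z)) + \<i> * complex_of_real (Im (g z)))"
    using assms by (intro poly_approx_add poly_approx_mult poly_approx_const
        poly_approx_arc_real_polynomial[where r = r])
  moreover have "complex_of_real (Re (g z)) + \<i> * complex_of_real (Im (g z)) = g z" for z
    by (simp add: complex_eq_iff)
  ultimately show "\<exists>v. poly_approx K v \<and> (\<forall>z\<in>K. cmod (\<phi> z - v z) < e)" using g(2) by auto
qed

lemma norm_divide_one_minus_le:
  fixes x :: complex
  assumes "cmod x \<le> k" "k \<le> 1/2"
  shows "cmod (x / (1 - x)) \<le> 2 * k"
proof -
  have "cmod (1 - x) \<ge> 1 / 2" using norm_triangle_ineq2[of 1 x] assms by simp
  then have "cmod x / cmod (1 - x) \<le> k / (1 / 2)"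
    using assms order_trans[OF norm_ge_zero assms(1)] by (intro frac_le) auto
  then show ?thesis by (simp add: norm_divide)
qed

text \<open>A polynomial close to \<open>\<phi>\<close> on the arc is switched off on the disc by a
  rational factor. Its poles lie on the circle |z| = t with s < t < r, hence off both pieces, and so
  it is itself a limit of polynomials.\<close>

lemma poly_approx_disc_arc:
  fixes s r :: real and c :: complex
  assumes s: "0 \<le> s" "s < r" and c: "cmod c = r" and "d > 0"
    and cont: "continuous_on (sphere 0 r - ball c d) \<phi>"
  shows "poly_approx (cball 0 s \<union> (sphere 0 r - ball c d)) (\<lambda>z. if cmod z \<le> s then 0 else \<phi> z)"
    (is "poly_approx ?L ?u")
proof (rule poly_approx_limit)
  fix e :: real assume "e > 0"
  define K where "K = sphere 0 r - ball c d"
  have r: "r > 0" using s by simp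
  have K: "compact K" unfolding K_def by (intro compact_diff) auto
  have L: "compact ?L" using K unfolding K_def by (intro compact_Un) auto
  have conn: "connected (- ?L)" using connected_compl_disc_arc[OF s(2) r c \<open>d > 0\<close>] .
  have "cball (0::complex) (- 1) = {}" by simp
  then have connK: "connected (- K)"
    using connected_compl_disc_arc[of "- 1" r c d] r c \<open>d > 0\<close> by (simp add: K_def)
  have "poly_approx K \<phi>"
    using K connK r cont by (intro poly_approx_arc[where r = r]) (auto simp: K_def)
  moreover have "e / 2 > 0" using \<open>e > 0\<close> by simp
  ultimately obtain q where q: "\<And>z. z \<in> K \<Longrightarrow> cmod (\<phi> z - poly q z) < e / 2"
    using poly_approxD by blast
  obtain B where B: "B > 0" "\<And>z. z \<in> ?L \<Longrightarrow> cmod (poly q z) < B"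
    using poly_bounded_on_compact[OF L] by blast
  define t where "t = (s + r) / 2"
  have t: "s < t" "t < r" "t > 0" using s by (auto simp: t_def)
  \<comment> \<open>\<open>k\<close> bounds |z / t| on the disc and |t / z| on the circle, so that
    one exponent \<open>n\<close> serves both. The bound 1/2 for \<open>k ^ n\<close> keeps the
    denominators away from 0, and \<open>e / (4 * B)\<close> makes the resulting error
    \<open>2 * k ^ n * B\<close> less than \<open>e / 2\<close>.\<close>
  define k where "k = max (s / t) (t / r)"
  have k: "0 \<le> k" "k < 1" "s / t \<le> k" "t / r \<le> k" using s t r by (auto simp: k_def max_def)
  have "(\<lambda>n. k ^ n) \<longlonglongrightarrow> 0" using k by (intro LIMSEQ_realpow_zero) auto
  moreover have "min (1 / 2) (e / (4 * B)) > 0" using \<open>e > 0\<close> B by simp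
  ultimately have "\<forall>\<^sub>F n in sequentially. k ^ n < min (1 / 2) (e / (4 * B))"
    by (rule order_tendstoD)
  moreover have "\<forall>\<^sub>F n in sequentially. n > (0::nat)" by (rule eventually_gt_at_top)
  ultimately have "\<forall>\<^sub>F n in sequentially. k ^ n < min (1 / 2) (e / (4 * B)) \<and> n > 0"
    by eventually_elim simp
  then obtain n where n: "k ^ n < 1 / 2" "k ^ n < e / (4 * B)" "n > 0"
    using eventually_happens by force
  have kB: "2 * k ^ n * B < e / 2" using n(2) B by (simp add: field_simps)
  \<comment> \<open>\<open>1 / (1 - (z / t) ^ n)\<close> is close to \<open>1\<close> inside the circle of radius \<open>t\<close> and close to \<open>0\<close> outside.\<close>
  define Q where "Q = 1 - [:0, 1 / complex_of_real t:] ^ n"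
  have Qz: "poly Q z = 1 - (z / of_real t) ^ n" for z by (simp add: Q_def)
  have Q0: "Q \<noteq> 0"
  proof
    assume "Q = 0"
    then have "poly Q 0 = 0" by simp
    then show False using n(3) by (simp add: Qz zero_power)
  qed
  have small: "cmod ((z / of_real t) ^ n) \<le> k ^ n" if "cmod z \<le> s" for z
  proof -
    have "cmod (z / of_real t) \<le> s / t" using that t by (simp add: norm_divide divide_right_mono)
    then show ?thesis unfolding norm_power using k by (intro power_mono) auto
  qed
  have large: "cmod ((of_real t / z) ^ n) \<le> k ^ n" if "cmod z = r" for z
  proof -
    have "cmod (of_real t / z) \<le> k" using that t k by (simp add: norm_divide)
    then show ?thesis unfolding norm_power by (intro power_mono) auto
  qed
  have nz: "poly Q z \<noteq> 0" if "z \<in> ?L" for z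
  proof
    assume "poly Q z = 0"
    then have x: "(z / of_real t) ^ n = 1" by (simp add: Qz)
    then have "inverse ((z / of_real t) ^ n) = 1" by simp
    then have y: "(of_real t / z) ^ n = 1" by (simp add: power_divide)
    show False
    proof (cases "cmod z \<le> s")
      case True
      then show False using small[of z] x n(1) by simp
    next
      case False
      then show False using that large[of z] y n(1) by auto
    qed
  qed
  define v where "v = (\<lambda>z. poly q z * (1 + (- 1) * (1 / poly Q z)))"
  have "poly_approx ?L v" unfolding v_def
    using nz Q0 by (intro poly_approx_mult poly_approx_add poly_approx_poly poly_approx_const
        poly_approx_inverse_poly L conn) auto
  moreover have "cmod (?u z - v z) < e" if z: "z \<in> ?L" for z
  proof (cases "cmod z \<le> s")
    case True
    define x where "x = (z / of_real t) ^ n"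
    have "x \<noteq> 1" using nz[OF z] by (simp add: Qz x_def)
    moreover have "poly Q z = 1 - x" by (simp add: Qz x_def)
    ultimately have "1 + (- 1) * (1 / poly Q z) = - (x / (1 - x))" by (simp add: divide_simps)
    then have "cmod (?u z - v z) = cmod (poly q z) * cmod (x / (1 - x))"
      using True by (simp only: v_def if_True diff_0 norm_minus_cancel norm_mult)
    also have "\<dots> \<le> B * (2 * k ^ n)"
      using norm_divide_one_minus_le[of x "k ^ n"] small[OF True] n(1) B(2)[OF z] B(1)
      by (intro mult_mono) (auto simp: x_def)
    finally show ?thesis using kB \<open>e > 0\<close> by (simp add: algebra_simps)
  next
    case False
    then have zr: "cmod z = r" "z \<in> K" "z \<noteq> 0" using z r by (auto simp: K_def)
    define x where "x = (z / of_real t) ^ n"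
    define y where "y = (of_real t / z) ^ n"
    have "x \<noteq> 1" using nz[OF z] by (simp add: Qz x_def)
    have xy: "x * y = 1" using zr t by (simp add: x_def y_def power_mult_distrib[symmetric])
    then have "x \<noteq> 0" by auto
    have "y \<noteq> 1" using xy \<open>x \<noteq> 1\<close> by (metis mult.right_neutral)
    \<comment> \<open>On the circle \<open>x\<close> is large, so \<open>1 / (1 - x)\<close> is
      rewritten in terms of its small inverse \<open>y\<close>.\<close>
    have "1 - y = - y * (1 - x)" using xy by (simp add: algebra_simps)
    then have "1 / (1 - x) = - (y / (1 - y))"
      using xy by (cases "y = 0") simp_all
    then have h: "1 / poly Q z = - (y / (1 - y))" by (simp add: Qz x_def)
    have "?u z - v z = (\<phi> z - poly q z) - poly q z * (y / (1 - y))"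
      unfolding v_def h using False by (simp add: algebra_simps)
    then have "cmod (?u z - v z) \<le> cmod (\<phi> z - poly q z) + cmod (poly q z) * cmod (y / (1 - y))"
      using norm_triangle_ineq4[of "\<phi> z - poly q z" "poly q z * (y / (1 - y))"]
      by (simp only: norm_mult)
    also have "cmod (poly q z) * cmod (y / (1 - y)) \<le> B * (2 * k ^ n)"
      using norm_divide_one_minus_le[of y "k ^ n"] large[OF zr(1)] n(1) B(2)[OF z] B(1)
      by (intro mult_mono) (auto simp: y_def)
    finally show ?thesis using kB q[OF zr(2)] by (simp add: algebra_simps)
  qed
  ultimately show "\<exists>v. poly_approx ?L v \<and> (\<forall>z\<in>?L. cmod (?u z - v z) < e)" by blast
qed

lemma poly_approx_insert:
  assumes L: "compact L" "connected (- L)" and x: "x \<notin> L" and u: "poly_approx L u"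
  shows "poly_approx (insert x L) (\<lambda>z. if z = x then v else u z)"
proof (rule poly_approx_limit)
  fix e :: real assume "e > 0"
  have cl: "closed L" using L(1) by (rule compact_imp_closed)
  have conn: "connected (- insert x L)"
  proof -
    have "connected (- L - {x})"
      using cl L(2) by (intro connected_open_diff_countable) auto
    also have "- L - {x} = - insert x L" by auto
    finally show ?thesis .
  qed
  obtain d where d: "d > 0" "ball x d \<subseteq> - L"
    using openE[of "- L" x] cl x by (auto simp: open_Compl)
  have "e / 2 > 0" using \<open>e > 0\<close> by simp
  then obtain p where p: "\<And>z. z \<in> L \<Longrightarrow> cmod (u z - poly p z) < e / 2"
    using poly_approxD[OF u] by blast
  \<comment> \<open>The summand 1 makes \<open>M\<close> positive. Below,
    \<open>t \<le> d / 2\<close> keeps the pole \<open>a\<close> at distance at least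
    \<open>d / 2\<close> from \<open>L\<close>, and \<open>t \<le> e * d / (4 * M)\<close> bounds
    the correction on \<open>L\<close> by \<open>M * t / (d / 2) \<le> e / 2\<close>.\<close>
  define M where "M = cmod (v - poly p x) + 1"
  have M: "M > 0" by (simp add: M_def add_nonneg_pos)
  define t where "t = min (d / 2) (e * d / (4 * M))"
  have t: "t > 0" "t \<le> d / 2" "t \<le> e * d / (4 * M)" using d \<open>e > 0\<close> M by (auto simp: t_def)
  define a where "a = x + of_real t"
  have far: "cmod (z - a) \<ge> d / 2" if "z \<in> L" for z
  proof -
    have "cmod (z - x) \<ge> d" using that d(2) by (force simp: dist_norm norm_minus_commute)
    moreover have "cmod (z - x) \<le> cmod (z - a) + t"
      using norm_triangle_ineq[of "z - a" "of_real t"] t by (simp add: a_def)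
    ultimately show ?thesis using t by simp
  qed
  have a: "a \<notin> insert x L"
    using t far[of a] d(1) by (auto simp: a_def)
  have ax: "x - a = - of_real t" by (simp add: a_def)
  \<comment> \<open>The factor \<open>(x - a) / (z - a)\<close> is \<open>1\<close> at \<open>x\<close> and tends to \<open>0\<close> uniformly on \<open>L\<close> as \<open>a\<close> tends to \<open>x\<close>.\<close>
  define w where "w = (\<lambda>z. poly p z + (v - poly p x) * (x - a) * (1 / (z - a)))"
  have "poly_approx (insert x L) w" unfolding w_def
    using L conn a by (intro poly_approx_add poly_approx_mult poly_approx_poly
        poly_approx_const poly_approx_pole) auto
  moreover have "cmod ((if z = x then v else u z) - w z) < e" if z: "z \<in> insert x L" for z
  proof (cases "z = x")
    case True
    have "x - a \<noteq> 0" using a by auto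
    then have "w x = v" by (simp add: w_def)
    then show ?thesis using True \<open>e > 0\<close> by simp
  next
    case False
    then have zL: "z \<in> L" using z by simp
    have "cmod ((v - poly p x) * (x - a) * (1 / (z - a))) = cmod (v - poly p x) * t / cmod (z - a)"
      using t by (simp add: norm_mult norm_divide ax)
    also have "\<dots> \<le> M * (e * d / (4 * M)) / (d / 2)"
      using t M far[OF zL] d \<open>e > 0\<close> by (intro frac_le mult_mono) (auto simp: M_def)
    also have "\<dots> = e / 2" using M d by (simp add: field_simps)
    finally have "cmod ((v - poly p x) * (x - a) * (1 / (z - a))) \<le> e / 2" .
    then show ?thesis
      using norm_triangle_ineq4[of "u z - poly p z" "(v - poly p x) * (x - a) * (1 / (z - a))"]
        p[OF zL] False by (simp add: w_def algebra_simps)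
  qed
  ultimately show "\<exists>w. poly_approx (insert x L) w \<and>
      (\<forall>z\<in>insert x L. cmod ((if z = x then v else u z) - w z) < e)" by blast
qed

lemma poly_approx_Un_finite:
  assumes X: "finite X" "X \<inter> L = {}" and L: "compact L" "connected (- L)"
    and u: "poly_approx L u"
  shows "poly_approx (X \<union> L) (\<lambda>z. if z \<in> X then v z else u z)"
  using X
proof (induction X rule: finite_induct)
  case empty
  then show ?case using u by simp
next
  case (insert x X)
  have "connected (- L - X)"
    using insert(1) L by (intro connected_open_diff_countable countable_finite)
      (auto simp: open_Compl compact_imp_closed)
  moreover have "- L - X = - (X \<union> L)" by auto
  moreover have "compact (X \<union> L)" using finite_imp_compact[OF insert(1)] L(1) by (rule compact_Un)
  ultimately have "poly_approx (insert x (X \<union> L))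
      (\<lambda>z. if z = x then v x else if z \<in> X then v z else u z)"
    using insert by (intro poly_approx_insert) auto
  then show ?case unfolding Un_insert_left by (rule poly_approx_cong) auto
qed

section \<open>Construction of Abel universal functions\<close>

text \<open>Together with \<open>abel_universalI\<close> this trades subsequences for one
  approximation at a single, arbitrarily late index, the form in which universality is used and
  proved from here on.\<close>

lemma abel_universalD:
  assumes "f \<in> abel_universal \<rho>" "compact K" "K \<subseteq> sphere 0 1" "K \<noteq> sphere 0 1"
    "continuous_on K \<phi>" "e > 0"
  shows "\<exists>n\<ge>N. \<forall>\<zeta>\<in>K. cmod (f (complex_of_real (\<rho> n) * \<zeta>) - \<phi> \<zeta>) < e"
proof -
  obtain n where n: "strict_mono n"
    "uniform_limit K (\<lambda>k \<zeta>. f (complex_of_real (\<rho> (n k)) * \<zeta>)) \<phi> sequentially"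
    using assms unfolding abel_universal_def by blast
  have "\<forall>\<^sub>F k in sequentially. \<forall>\<zeta>\<in>K. dist (f (complex_of_real (\<rho> (n k)) * \<zeta>)) (\<phi> \<zeta>) < e"
    using n(2) assms(6) by (rule uniform_limitD)
  moreover have "\<forall>\<^sub>F k in sequentially. k \<ge> N" by (rule eventually_ge_at_top)
  ultimately have "\<forall>\<^sub>F k in sequentially.
      (\<forall>\<zeta>\<in>K. dist (f (complex_of_real (\<rho> (n k)) * \<zeta>)) (\<phi> \<zeta>) < e) \<and> k \<ge> N"
    by (rule eventually_conj)
  then obtain k where k: "\<forall>\<zeta>\<in>K. dist (f (complex_of_real (\<rho> (n k)) * \<zeta>)) (\<phi> \<zeta>) < e" "k \<ge> N"
    using eventually_happens by force
  have "n k \<ge> N" using k(2) seq_suble[OF n(1), of k] by simp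
  then show ?thesis using k(1) by (intro exI[of _ "n k"]) (auto simp: dist_norm)
qed

lemma abel_universalI:
  assumes "f holomorphic_on ball 0 1"
    and "\<And>K \<phi> e N. \<lbrakk>compact K; K \<subseteq> sphere 0 1; K \<noteq> sphere 0 1; continuous_on K \<phi>; e > 0\<rbrakk> \<Longrightarrow>
      \<exists>n\<ge>N. \<forall>\<zeta>\<in>K. cmod (f (complex_of_real (\<rho> n) * \<zeta>) - \<phi> \<zeta>) < e"
  shows "f \<in> abel_universal \<rho>"
proof -
  have "\<exists>n. strict_mono n \<and>
      uniform_limit K (\<lambda>k \<zeta>. f (complex_of_real (\<rho> (n k)) * \<zeta>)) \<phi> sequentially"
    if K: "compact K" "K \<subseteq> sphere 0 1" "K \<noteq> sphere 0 1" "continuous_on K \<phi>" for K \<phi>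
  proof -
    define P where "P = (\<lambda>k n. \<forall>\<zeta>\<in>K. cmod (f (complex_of_real (\<rho> n) * \<zeta>) - \<phi> \<zeta>) < inverse (Suc k))"
    have ex: "\<exists>n\<ge>N. P k n" for N k
      unfolding P_def using assms(2)[OF K] by (meson inverse_positive_iff_positive of_nat_0_less_iff zero_less_Suc)
    have "\<exists>n. \<forall>k. P k (n k) \<and> n k < n (Suc k)"
      using ex by (intro dependent_nat_choice) (metis Suc_le_eq)+
    then obtain n where n: "\<And>k. P k (n k)" "\<And>k. n k < n (Suc k)" by blast
    have "uniform_limit K (\<lambda>k \<zeta>. f (complex_of_real (\<rho> (n k)) * \<zeta>)) \<phi> sequentially"
      unfolding uniform_limit_iff
    proof (intro allI impI)
      fix e :: real assume "e > 0"
      then obtain M where M: "inverse (real (Suc M)) < e" using reals_Archimedean by blast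
      show "\<forall>\<^sub>F k in sequentially. \<forall>\<zeta>\<in>K. dist (f (complex_of_real (\<rho> (n k)) * \<zeta>)) (\<phi> \<zeta>) < e"
        using eventually_ge_at_top[of M]
      proof eventually_elim
        fix k assume "k \<ge> M"
        then have "inverse (real (Suc k)) \<le> inverse (real (Suc M))"
          by (intro le_imp_inverse_le) auto
        then show "\<forall>\<zeta>\<in>K. dist (f (complex_of_real (\<rho> (n k)) * \<zeta>)) (\<phi> \<zeta>) < e"
          using n(1)[of k] M unfolding P_def dist_norm by (meson order.strict_trans order.strict_trans2)
      qed
    qed
    then show ?thesis using n(2) strict_mono_Suc_iff by blast
  qed
  then show ?thesis using assms(1) unfolding abel_universal_def by blast
qed

section \<open>A countable family of targets\<close>

text \<open>Coded by lists of pairs of rationals, so that targets form a countable type and can be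
  enumerated by \<open>from_nat\<close>.\<close>

definition rational_poly :: "(rat \<times> rat) list \<Rightarrow> complex poly" where
  "rational_poly l = Poly (map (\<lambda>(a, b). Complex (of_rat a) (of_rat b)) l)"

text \<open>Horner's scheme: on the closed unit disc multiplication by \<open>z\<close> does not
  enlarge the error, so the constant coefficient may use one half of the tolerance and the tail the
  other.\<close>

lemma rational_poly_dense:
  assumes "e > 0"
  shows "\<exists>l. \<forall>z\<in>cball 0 1. cmod (poly (rational_poly l) z - poly q z) < e"
  using assms
proof (induction q arbitrary: e)
  case 0
  then show ?case by (intro exI[of _ "[]"]) (simp add: rational_poly_def)
next
  case (pCons a q)
  obtain l where l: "\<And>z. z \<in> cball 0 1 \<Longrightarrow> cmod (poly (rational_poly l) z - poly q z) < e / 2"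
    using pCons.IH[of "e / 2"] pCons.prems by (meson half_gt_zero)
  obtain x where x: "Re a - e / 4 < of_rat x" "of_rat x < Re a + e / 4"
    using of_rat_dense[of "Re a - e / 4" "Re a + e / 4"] pCons.prems by auto
  obtain y where y: "Im a - e / 4 < of_rat y" "of_rat y < Im a + e / 4"
    using of_rat_dense[of "Im a - e / 4" "Im a + e / 4"] pCons.prems by auto
  define c where "c = Complex (of_rat x) (of_rat y)"
  have "\<bar>Re (c - a)\<bar> < e / 4" "\<bar>Im (c - a)\<bar> < e / 4" using x y unfolding c_def minus_complex.sel complex.sel by linarith+
  then have c: "cmod (c - a) < e / 2" using cmod_le[of "c - a"] by linarith
  have "cmod (poly (rational_poly ((x, y) # l)) z - poly (pCons a q) z) < e" if z: "z \<in> cball 0 1" for z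
  proof -
    have eq: "poly (rational_poly ((x, y) # l)) z - poly (pCons a q) z
        = (c - a) + z * (poly (rational_poly l) z - poly q z)"
      by (simp add: rational_poly_def c_def algebra_simps)
    have "cmod (z * (poly (rational_poly l) z - poly q z))
        \<le> 1 * cmod (poly (rational_poly l) z - poly q z)"
      unfolding norm_mult using z by (intro mult_right_mono) auto
    then show ?thesis unfolding eq
      using norm_triangle_ineq[of "c - a" "z * (poly (rational_poly l) z - poly q z)"] c l[OF z]
      by linarith
  qed
  then show ?case by blast
qed

text \<open>Countably many arcs that are cofinal among the proper compact subsets of the circle:
  such a set misses a ball about some point of the circle, and points of rational angle are
  dense.\<close>

definition rational_arc :: "rat \<Rightarrow> nat \<Rightarrow> complex set" where
  "rational_arc x m = sphere 0 1 - ball (cis (of_rat x)) (inverse (Suc m))"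

lemma rational_arc_superset:
  assumes K: "compact K" "K \<subseteq> sphere 0 1" "K \<noteq> sphere 0 1"
  obtains x m where "K \<subseteq> rational_arc x m"
proof -
  obtain c where c: "c \<in> sphere 0 1" "c \<notin> K" using K by blast
  have "open (- K)" using K(1) by (simp add: compact_imp_closed open_Compl)
  then obtain d where d: "d > 0" "ball c d \<subseteq> - K" using c openE[of "- K" c] by auto
  have "c = cis (Arg c)" using c(1) rcis_cmod_Arg[of c] by (simp add: rcis_def)
  have "isCont (\<lambda>t. exp (\<i> * of_real t)) (Arg c)" by (intro continuous_intros)
  then have "isCont cis (Arg c)" by (simp add: cis_conv_exp[abs_def])
  moreover have "d / 2 > 0" using d by simp
  ultimately obtain t where t: "t > 0" "\<And>y. dist y (Arg c) < t \<Longrightarrow> dist (cis y) (cis (Arg c)) < d / 2"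
    unfolding continuous_at_eps_delta by (metis dist_commute)
  obtain x where x: "Arg c - t < of_rat x" "of_rat x < Arg c + t"
    using of_rat_dense[of "Arg c - t" "Arg c + t"] t by auto
  then have "dist (cis (of_rat x)) c < d / 2"
    using t(2)[of "of_rat x"] \<open>c = cis (Arg c)\<close> by (auto simp: dist_real_def)
  obtain m where m: "inverse (real (Suc m)) < d / 2"
    using reals_Archimedean[OF \<open>d / 2 > 0\<close>] by blast
  have "K \<subseteq> rational_arc x m"
  proof
    fix z assume z: "z \<in> K"
    then have "dist c z \<ge> d" using d by force
    then have "dist (cis (of_rat x)) z \<ge> d / 2"
      using \<open>dist (cis (of_rat x)) c < d / 2\<close> dist_triangle[of c z "cis (of_rat x)"]
      by (simp add: dist_commute)
    then show "z \<in> rational_arc x m" using m z K by (auto simp: rational_arc_def)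
  qed
  then show ?thesis by (rule that)
qed

text \<open>\<open>\<phi>\<close> is first extended from \<open>K\<close> to a rational arc, whose
  complement is known to be connected, and approximated there.\<close>

lemma rational_target:
  assumes K: "compact K" "K \<subseteq> sphere 0 1" "K \<noteq> sphere 0 1" "continuous_on K \<phi>" and "e > 0"
  obtains x m l where "K \<subseteq> rational_arc x m"
    "\<forall>z\<in>K. cmod (poly (rational_poly l) z - \<phi> z) < e"
proof -
  obtain x m where xm: "K \<subseteq> rational_arc x m" using rational_arc_superset[OF K(1-3)] .
  define J where "J = rational_arc x m"
  have J: "compact J" "J \<subseteq> sphere 0 1" unfolding J_def rational_arc_def
    by (auto intro: compact_diff)
  have "cball (0::complex) (- 1) = {}" by simp
  then have conn: "connected (- J)"
    using connected_compl_disc_arc[of "- 1" 1 "cis (of_rat x)" "inverse (Suc m)"]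
    by (simp add: J_def rational_arc_def)
  have "closedin (top_of_set J) K"
    using K(1) xm by (simp add: J_def closed_subset compact_imp_closed)
  then obtain \<psi> where \<psi>: "continuous_on J \<psi>" "\<And>z. z \<in> K \<Longrightarrow> \<psi> z = \<phi> z"
    using Tietze_unbounded[OF K(4)] by metis
  have "poly_approx J \<psi>"
    using J conn \<psi> by (intro poly_approx_arc[where r = 1]) auto
  moreover have "e / 2 > 0" using \<open>e > 0\<close> by simp
  ultimately obtain q where q: "\<And>z. z \<in> J \<Longrightarrow> cmod (\<psi> z - poly q z) < e / 2"
    using poly_approxD by blast
  obtain l where l: "\<And>z. z \<in> cball 0 1 \<Longrightarrow> cmod (poly (rational_poly l) z - poly q z) < e / 2"
    using rational_poly_dense[OF \<open>e / 2 > 0\<close>] by blast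
  have "cmod (poly (rational_poly l) z - \<phi> z) < e" if z: "z \<in> K" for z
  proof -
    have "cmod (poly (rational_poly l) z - poly q z) < e / 2" using K z by (intro l) auto
    moreover have "cmod (\<phi> z - poly q z) < e / 2" using q \<psi> z xm by (force simp: J_def)
    ultimately show ?thesis
      using norm_triangle_ineq4[of "poly (rational_poly l) z - poly q z" "\<phi> z - poly q z"] by simp
  qed
  then show ?thesis using xm that by blast
qed

section \<open>Inductive construction with control on a discrete set\<close>

context
  fixes \<rho> :: "nat \<Rightarrow> real"
  assumes \<rho>: "range \<rho> \<subseteq> {0..<1}" "\<rho> \<longlonglongrightarrow> 1"
begin

text \<open>A single correction \<open>h\<close> is made small on the old disc, close to the target
  minus \<open>p\<close> on the arc, and close to \<open>- p\<close> at the finitely many points of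
  \<open>X\<close> in the next annulus. These requirements do not conflict: \<open>X\<close> avoids
  the circle of radius \<open>\<rho> n\<close>, and only its points of modulus above
  \<open>s\<close> are treated. The radius \<open>(1 + \<rho> n) / 2\<close> lies beyond the arc,
  still below 1, and becomes the next \<open>s\<close>.\<close>

lemma universal_step:
  assumes X: "\<And>t. t < 1 \<Longrightarrow> finite (X \<inter> cball 0 t)" "\<And>x n. x \<in> X \<Longrightarrow> cmod x \<noteq> \<rho> n"
    and s: "0 \<le> s" "s < 1" and "e > 0"
  shows "\<exists>n p'. s < \<rho> n \<and> N \<le> n \<and> (\<forall>z\<in>cball 0 s. cmod (poly p' z - poly p z) < e) \<and>
    (\<forall>\<zeta>\<in>rational_arc x m. cmod (poly p' (complex_of_real (\<rho> n) * \<zeta>) - poly q \<zeta>) < e) \<and>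
    (\<forall>y\<in>X. s < cmod y \<and> cmod y \<le> (1 + \<rho> n) / 2 \<longrightarrow> cmod (poly p' y) < e)"
proof -
  have "\<forall>\<^sub>F n in sequentially. \<rho> n > s" using \<rho>(2) s(2) by (rule order_tendstoD)
  then have "\<forall>\<^sub>F n in sequentially. \<rho> n > s \<and> N \<le> n"
    using eventually_ge_at_top by (rule eventually_conj)
  then obtain n where n: "\<rho> n > s" "N \<le> n" using eventually_happens by force
  define r where "r = \<rho> n"
  have r: "s < r" "0 < r" "r < 1" using n s \<rho>(1) by (auto simp: r_def image_subset_iff)
  define c where "c = of_real r * cis (of_rat x)"
  define d where "d = r * inverse (Suc m)"
  have c: "cmod c = r" using r by (simp add: c_def norm_mult)
  have d: "d > 0" using r by (simp add: d_def)
  define A where "A = sphere 0 r - ball c d"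
  define L where "L = cball 0 s \<union> A"
  define Y where "Y = {y \<in> X. s < cmod y \<and> cmod y \<le> (1 + r) / 2}"
  have "finite (X \<inter> cball 0 ((1 + r) / 2))" using X(1) r(3) by simp
  moreover have "Y \<subseteq> X \<inter> cball 0 ((1 + r) / 2)" by (auto simp: Y_def)
  ultimately have Y: "finite Y" using finite_subset by blast
  have L: "compact L" "connected (- L)"
    unfolding L_def A_def using connected_compl_disc_arc[OF r(1,2) c d]
    by (auto intro!: compact_Un compact_diff)
  have YL: "Y \<inter> L = {}" using X(2)[of _ n] by (auto simp: Y_def L_def A_def r_def)
  define \<phi> where "\<phi> = (\<lambda>z. poly q (z / of_real r) - poly p z)"
  have "continuous_on A \<phi>" unfolding \<phi>_def using r by (intro continuous_intros) auto
  then have "poly_approx L (\<lambda>z. if cmod z \<le> s then 0 else \<phi> z)"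
    unfolding L_def A_def using s r c d by (intro poly_approx_disc_arc) auto
  then have "poly_approx (Y \<union> L)
      (\<lambda>z. if z \<in> Y then - poly p z else if cmod z \<le> s then 0 else \<phi> z)"
    using Y YL L by (intro poly_approx_Un_finite)
  then obtain h where h: "\<And>z. z \<in> Y \<union> L \<Longrightarrow>
      cmod ((if z \<in> Y then - poly p z else if cmod z \<le> s then 0 else \<phi> z) - poly h z) < e"
    using poly_approxD[OF _ \<open>e > 0\<close>] by blast
  have h1: "cmod (poly h z) < e" if "z \<in> cball 0 s" for z
  proof -
    have "z \<in> L" using that by (simp add: L_def)
    then have "z \<notin> Y" using YL by blast
    then show ?thesis using h[of z] that \<open>z \<in> L\<close> by simp
  qed
  have h2: "cmod (\<phi> z - poly h z) < e" if "z \<in> A" for z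
  proof -
    have "z \<in> L" "\<not> cmod z \<le> s" using that r by (auto simp: L_def A_def)
    moreover have "z \<notin> Y" using YL \<open>z \<in> L\<close> by blast
    ultimately show ?thesis using h[of z] by simp
  qed
  have h3: "cmod (- poly p z - poly h z) < e" if "z \<in> Y" for z
    using h[of z] that by simp
  show ?thesis
  proof (intro exI conjI ballI impI)
    fix z :: complex assume "z \<in> cball 0 s"
    then show "cmod (poly (p + h) z - poly p z) < e" using h1[of z] by simp
  next
    fix \<zeta> assume z: "\<zeta> \<in> rational_arc x m"
    define z where "z = of_real r * \<zeta>"
    have zr: "cmod z = r" using z r by (simp add: z_def rational_arc_def norm_mult)
    have "dist c z = cmod (of_real r * (cis (of_rat x) - \<zeta>))"
      unfolding dist_norm c_def z_def right_diff_distrib ..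
    also have "\<dots> = r * dist (cis (of_rat x)) \<zeta>"
      using r unfolding norm_mult norm_of_real dist_norm by simp
    finally have "z \<notin> ball c d" using z r by (simp add: rational_arc_def d_def)
    then have "z \<in> A" using zr by (simp add: A_def)
    moreover have "z / of_real r = \<zeta>" using r by (simp add: z_def)
    ultimately have "cmod (poly q \<zeta> - poly p z - poly h z) < e"
      using h2[of z] by (simp add: \<phi>_def)
    moreover have "poly (p + h) z - poly q \<zeta> = - (poly q \<zeta> - poly p z - poly h z)" by simp
    ultimately show "cmod (poly (p + h) (complex_of_real (\<rho> n) * \<zeta>) - poly q \<zeta>) < e"
      unfolding r_def[symmetric] z_def[symmetric] by (metis norm_minus_cancel)
  next
    fix y assume "y \<in> X" "s < cmod y \<and> cmod y \<le> (1 + \<rho> n) / 2"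
    then have "y \<in> Y" by (simp add: Y_def r_def)
    moreover have "poly (p + h) y = - (- poly p y - poly h y)" by simp
    ultimately show "cmod (poly (p + h) y) < e" using h3 by (metis norm_minus_cancel)
  qed (use n in auto)
qed

text \<open>A nonzero point of \<open>X\<close> receives a small value at the stage whose disc first
  contains it, and the later corrections there are summable. The case \<open>X = {}\<close> provides
  the existence of universal functions.\<close>

theorem abel_universal_controlled:
  assumes X: "\<And>t. t < 1 \<Longrightarrow> finite (X \<inter> cball 0 t)" "\<And>x n. x \<in> X \<Longrightarrow> cmod x \<noteq> \<rho> n"
    "X \<subseteq> ball 0 1"
  shows "\<exists>f \<in> abel_universal \<rho>. \<forall>x\<in>X. cmod (f x) \<le> 1"
proof -
  \<comment> \<open>Every target is met at infinitely many stages \<open>j\<close>, because of the unused second component of \<open>prod_decode j\<close>.\<close>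
  define tgt :: "nat \<Rightarrow> (rat \<times> rat) list \<times> rat \<times> nat" where "tgt j = from_nat (fst (prod_decode j))" for j
  define T where "T = (\<lambda>j. rational_poly (fst (tgt j)))"
  define A where "A = (\<lambda>j. rational_arc (fst (snd (tgt j))) (snd (snd (tgt j))))"
  \<comment> \<open>Halving makes the errors from stage \<open>j\<close> on sum to
    \<open>2 * e j\<close>; starting at 1/4 keeps the value at a point of \<open>X\<close>, at most
    \<open>e k + 2 * e (Suc k)\<close>, below 1.\<close>
  define e where "e = (\<lambda>j::nat. (1 / 2) ^ (j + 2) :: real)"
  have e: "e j > 0" for j by (simp add: e_def)
  \<comment> \<open>The start with polynomial 0 and radius 0 takes care of the point 0: it lies in
    no annulus \<open>s j < cmod y\<close> and is controlled by \<open>p 0 = 0\<close>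
    instead.\<close>
  define P where "P = (\<lambda>j (p :: complex poly, s :: real). 0 \<le> s \<and> s < 1 \<and> (j = (0::nat) \<longrightarrow> p = 0 \<and> s = 0))"
  define Q where "Q = (\<lambda>j (p :: complex poly, s :: real) (p', s'). \<exists>n\<ge>j. s < \<rho> n \<and> s' = (1 + \<rho> n) / 2 \<and>
    (\<forall>z\<in>cball 0 s. cmod (poly p' z - poly p z) < e j) \<and>
    (\<forall>\<zeta>\<in>A j. cmod (poly p' (complex_of_real (\<rho> n) * \<zeta>) - poly (T j) \<zeta>) < e j) \<and>
    (\<forall>y\<in>X. s < cmod y \<and> cmod y \<le> s' \<longrightarrow> cmod (poly p' y) < e j))"
  have \<rho>01: "0 \<le> \<rho> n" "\<rho> n < 1" for n using \<rho>(1) by (auto simp: image_subset_iff)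
  have "\<exists>F. \<forall>j. P j (F j) \<and> Q j (F j) (F (Suc j))"
  proof (rule dependent_nat_choice)
    show "\<exists>x. P 0 x" by (intro exI[of _ "(0, 0)"]) (simp add: P_def)
  next
    fix x j assume "P j x"
    then obtain p s where x: "x = (p, s)" "0 \<le> s" "s < 1" by (cases x) (auto simp: P_def)
    obtain n p' where n: "s < \<rho> n" "j \<le> n" "\<forall>z\<in>cball 0 s. cmod (poly p' z - poly p z) < e j"
      "\<forall>\<zeta>\<in>A j. cmod (poly p' (complex_of_real (\<rho> n) * \<zeta>) - poly (T j) \<zeta>) < e j"
      "\<forall>y\<in>X. s < cmod y \<and> cmod y \<le> (1 + \<rho> n) / 2 \<longrightarrow> cmod (poly p' y) < e j"
      using universal_step[OF X(1,2) x(2,3) e[of j], where N = j and p = p] unfolding A_def by blast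
    have "P (Suc j) (p', (1 + \<rho> n) / 2)" using \<rho>01[of n] by (simp add: P_def)
    moreover have "Q j x (p', (1 + \<rho> n) / 2)" unfolding Q_def x(1) using n by auto
    ultimately show "\<exists>y. P (Suc j) y \<and> Q j x y" by blast
  qed
  then obtain F where F: "\<And>j. P j (F j)" "\<And>j. Q j (F j) (F (Suc j))" by blast
  define p where "p = (\<lambda>j. fst (F j))"
  define s where "s = (\<lambda>j. snd (F j))"
  have s: "0 \<le> s j" "s j < 1" "s 0 = 0" "p 0 = 0" for j
    using F(1)[of j] F(1)[of 0] by (auto simp: P_def p_def s_def split: prod.splits)
  define R where "R = (\<lambda>j n. j \<le> n \<and> s j < \<rho> n \<and> s (Suc j) = (1 + \<rho> n) / 2 \<and>
    (\<forall>z\<in>cball 0 (s j). cmod (poly (p (Suc j)) z - poly (p j) z) < e j) \<and>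
    (\<forall>\<zeta>\<in>A j. cmod (poly (p (Suc j)) (complex_of_real (\<rho> n) * \<zeta>) - poly (T j) \<zeta>) < e j) \<and>
    (\<forall>y\<in>X. s j < cmod y \<and> cmod y \<le> s (Suc j) \<longrightarrow> cmod (poly (p (Suc j)) y) < e j))"
  have "\<exists>n. R j n" for j
    using F(2)[of j] unfolding Q_def R_def p_def s_def case_prod_beta .
  then obtain n where R: "\<And>j. R j (n j)" by metis
  have n: "n j \<ge> j" "s j < \<rho> (n j)" "s (Suc j) = (1 + \<rho> (n j)) / 2"
    "z \<in> cball 0 (s j) \<Longrightarrow> cmod (poly (p (Suc j)) z - poly (p j) z) < e j"
    "\<zeta> \<in> A j \<Longrightarrow> cmod (poly (p (Suc j)) (complex_of_real (\<rho> (n j)) * \<zeta>) - poly (T j) \<zeta>) < e j"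
    "y \<in> X \<Longrightarrow> s j < cmod y \<Longrightarrow> cmod y \<le> s (Suc j) \<Longrightarrow> cmod (poly (p (Suc j)) y) < e j"
    for j z \<zeta> y
    using R[of j] unfolding R_def by blast+
  have sS: "s j \<le> s (Suc j)" "\<rho> (n j) \<le> s (Suc j)" for j
    using n(2)[of j] \<rho>01[of "n j"] by (auto simp: n(3))
  have s_mono: "s i \<le> s j" if "i \<le> j" for i j using lift_Suc_mono_le[of s, OF sS(1) that] .
  \<comment> \<open>The choice of the new radius, together with \<open>s j < \<rho> (n j)\<close>,
    at least halves the distance to 1; hence the discs exhaust the unit disc.\<close>
  have s_lb: "1 - s j \<le> (1 / 2) ^ j" for j
  proof (induction j)
    case (Suc j)
    then show ?case using n(2,3)[of j] by simp
  qed (simp add: s)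
  have s_big: "\<exists>j. t < s j" if t: "t < 1" for t
  proof -
    obtain j where "(1 / 2) ^ j < 1 - t" using real_arch_pow_inv[of "1 - t" "1 / 2"] t by auto
    then show ?thesis using s_lb[of j] by (intro exI[of _ j]) simp
  qed
  \<comment> \<open>Since \<open>e\<close> halves at each stage, the sum of \<open>e i\<close> over
    \<open>j \<le> i < k\<close> is exactly \<open>2 * e j - 2 * e k\<close>; the subtracted term
    lets the induction close.\<close>
  have diff: "cmod (poly (p k) z - poly (p j) z) \<le> 2 * e j - 2 * e k"
    if "j \<le> k" "z \<in> cball 0 (s j)" for j k z
    using that(1)
  proof (induction k rule: dec_induct)
    case (step k)
    have "z \<in> cball 0 (s k)" using that(2) s_mono[OF step(1)] by auto
    then have "cmod (poly (p (Suc k)) z - poly (p k) z) < e k" by (rule n(4))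
    moreover have "e (Suc k) = e k / 2" by (simp add: e_def)
    ultimately show ?case
      using step(3) norm_triangle_ineq[of "poly (p (Suc k)) z - poly (p k) z" "poly (p k) z - poly (p j) z"]
      by simp
  qed simp
  then have diff': "cmod (poly (p k) z - poly (p j) z) \<le> 2 * e j"
    if "j \<le> k" "z \<in> cball 0 (s j)" for j k z
    using that e[of k] by fastforce
  define f where "f = (\<lambda>z. lim (\<lambda>k. poly (p k) z))"
  have e_small: "\<exists>J. \<forall>j\<ge>J. 4 * e j < d" if d: "d > 0" for d
  proof -
    obtain J where "(1 / 2) ^ J < d" using real_arch_pow_inv[of d "1 / 2"] d by auto
    moreover have "4 * e j \<le> (1 / 2) ^ J" if "j \<ge> J" for j
      using power_decreasing[OF that, of "1 / 2 :: real"] by (simp add: e_def)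
    ultimately show ?thesis by (meson le_less_trans)
  qed
  have f_lim: "(\<lambda>k. poly (p k) z) \<longlonglongrightarrow> f z" if z: "z \<in> ball 0 1" for z
  proof -
    obtain i where i: "cmod z < s i" using s_big[of "cmod z"] z by auto
    have "Cauchy (\<lambda>k. poly (p k) z)"
    proof (rule metric_CauchyI)
      fix d :: real assume "d > 0"
      then obtain J where J: "\<forall>j\<ge>J. 4 * e j < d" using e_small by blast
      define M where "M = max i J"
      have zM: "z \<in> cball 0 (s M)" using i s_mono[of i M] by (auto simp: M_def)
      have M: "cmod (poly (p k) z - poly (p M) z) \<le> 2 * e M" if "k \<ge> M" for k
        using diff'[OF that zM] .
      have "4 * e M < d" using J by (simp add: M_def)
      then have "dist (poly (p k) z) (poly (p l) z) < d" if "k \<ge> M" "l \<ge> M" for k l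
        using M[OF that(1)] M[OF that(2)]
          norm_triangle_ineq4[of "poly (p k) z - poly (p M) z" "poly (p l) z - poly (p M) z"]
        by (simp add: dist_norm)
      then show "\<exists>M. \<forall>m\<ge>M. \<forall>n\<ge>M. dist (poly (p m) z) (poly (p n) z) < d" by blast
    qed
    then show ?thesis unfolding f_def by (simp add: Cauchy_convergent_iff convergent_LIMSEQ_iff)
  qed
  have f_near: "cmod (f z - poly (p j) z) \<le> 2 * e j" if z: "z \<in> cball 0 (s j)" for j z
  proof -
    have "z \<in> ball 0 1" using z s(2)[of j] by auto
    then have "(\<lambda>k. cmod (poly (p k) z - poly (p j) z)) \<longlonglongrightarrow> cmod (f z - poly (p j) z)"
      by (intro tendsto_intros f_lim)
    then show ?thesis
      by (rule LIMSEQ_le_const2) (use diff' z in blast)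
  qed
  have "f holomorphic_on ball 0 1"
  proof (rule holomorphic_uniform_sequence[where f = "\<lambda>k. poly (p k)"])
    fix x :: complex assume x: "x \<in> ball 0 1"
    obtain i where i: "(1 + cmod x) / 2 < s i" using s_big[of "(1 + cmod x) / 2"] x by auto
    define d where "d = (1 - cmod x) / 2"
    have d: "cmod y \<le> (1 + cmod x) / 2" if "y \<in> cball x d" for y
      using that norm_triangle_ineq2[of y x] by (simp add: d_def dist_norm norm_minus_commute field_simps)
    have "uniform_limit (cball x d) (\<lambda>k. poly (p k)) f sequentially"
      unfolding uniform_limit_iff
    proof (intro allI impI)
      fix h :: real assume "h > 0"
      then obtain J where J: "\<forall>j\<ge>J. 4 * e j < h" using e_small by blast
      show "\<forall>\<^sub>F k in sequentially. \<forall>y\<in>cball x d. dist (poly (p k) y) (f y) < h"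
        using eventually_ge_at_top[of "max i J"]
      proof eventually_elim
        fix k assume k: "k \<ge> max i J"
        show "\<forall>y\<in>cball x d. dist (poly (p k) y) (f y) < h"
        proof
          fix y assume "y \<in> cball x d"
          then have "y \<in> cball 0 (s k)" using d[of y] i s_mono[of i k] k by simp
          then have "cmod (f y - poly (p k) y) \<le> 2 * e k" by (rule f_near)
          then show "dist (poly (p k) y) (f y) < h" using J k e[of k]
            by (auto simp: dist_norm norm_minus_commute dest!: spec[of _ k])
        qed
      qed
    qed
    moreover have "d > 0" using x by (simp add: d_def)
    moreover have "cball x d \<subseteq> ball 0 1"
    proof
      fix y assume "y \<in> cball x d"
      then show "y \<in> ball 0 1" using d[of y] x by simp
    qed
    ultimately show "\<exists>d. 0 < d \<and> cball x d \<subseteq> ball 0 1 \<and>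
        uniform_limit (cball x d) (\<lambda>k. poly (p k)) f sequentially" by blast
  qed (auto intro!: holomorphic_intros)
  then have "f \<in> abel_universal \<rho>"
  proof (rule abel_universalI)
    fix K :: "complex set" and \<phi> :: "complex \<Rightarrow> complex" and h :: real and N
    assume K: "compact K" "K \<subseteq> sphere 0 1" "K \<noteq> sphere 0 1" "continuous_on K \<phi>" and "h > 0"
    then have "h / 2 > 0" by simp
    obtain x m l where lxm: "K \<subseteq> rational_arc x m"
      "\<forall>z\<in>K. cmod (poly (rational_poly l) z - \<phi> z) < h / 2"
      using rational_target[OF K \<open>h / 2 > 0\<close>] .
    obtain J where J: "\<forall>j\<ge>J. 4 * e j < h / 2" using e_small[OF \<open>h / 2 > 0\<close>] by blast
    \<comment> \<open>The second component pushes the stage past \<open>N\<close>, which makes the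
      index \<open>n j \<ge> j\<close> late enough, and past \<open>J\<close>, which makes the
      tolerance \<open>e j\<close> small enough.\<close>
    define j where "j = prod_encode (to_nat (l, x, m), max N J)"
    have j: "j \<ge> max N J" unfolding j_def by (rule le_prod_encode_2)
    have "tgt j = (l, x, m)" by (simp add: tgt_def j_def)
    then have TA: "T j = rational_poly l" "A j = rational_arc x m" by (simp_all add: T_def A_def)
    have "cmod (f (complex_of_real (\<rho> (n j)) * \<zeta>) - \<phi> \<zeta>) < h" if z: "\<zeta> \<in> K" for \<zeta>
    proof -
      define w where "w = complex_of_real (\<rho> (n j)) * \<zeta>"
      have "cmod w = \<rho> (n j)" using z K(2) \<rho>01[of "n j"] by (auto simp: w_def norm_mult)
      then have "w \<in> cball 0 (s (Suc j))" using sS[of j] by simp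
      then have 1: "cmod (f w - poly (p (Suc j)) w) \<le> 2 * e (Suc j)" by (rule f_near)
      have 2: "cmod (poly (p (Suc j)) w - poly (rational_poly l) \<zeta>) < e j"
        using n(5)[of \<zeta> j] z lxm(1) by (auto simp: TA w_def)
      have 3: "cmod (poly (rational_poly l) \<zeta> - \<phi> \<zeta>) < h / 2" using lxm(2) z by blast
      have "f w - \<phi> \<zeta> = (f w - poly (p (Suc j)) w) + ((poly (p (Suc j)) w - poly (rational_poly l) \<zeta>)
          + (poly (rational_poly l) \<zeta> - \<phi> \<zeta>))" by simp
      then have "cmod (f w - \<phi> \<zeta>) \<le> cmod (f w - poly (p (Suc j)) w)
          + (cmod (poly (p (Suc j)) w - poly (rational_poly l) \<zeta>)
          + cmod (poly (rational_poly l) \<zeta> - \<phi> \<zeta>))"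
        by (metis norm_triangle_le norm_triangle_ineq add_left_mono)
      moreover have "e (Suc j) = e j / 2" by (simp add: e_def)
      moreover have "4 * e j < h / 2" using J j by simp
      ultimately show ?thesis using 1 2 3 e[of j] unfolding w_def[symmetric] by linarith
    qed
    moreover have "n j \<ge> N" using n(1)[of j] j by simp
    ultimately show "\<exists>n\<ge>N. \<forall>\<zeta>\<in>K. cmod (f (complex_of_real (\<rho> n) * \<zeta>) - \<phi> \<zeta>) < h" by blast
  qed
  moreover have "cmod (f x) \<le> 1" if x: "x \<in> X" for x
  proof (cases "x = 0")
    case True
    then have "cmod (f x - poly (p 0) x) \<le> 2 * e 0" by (intro f_near) (simp add: s)
    then show ?thesis by (simp add: s e_def)
  next
    case False
    have "cmod x < 1" using x X(3) by auto
    then obtain i where i: "cmod x < s i" using s_big by blast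
    define j where "j = (LEAST j. cmod x \<le> s j)"
    have j: "cmod x \<le> s j" unfolding j_def using LeastI[of "\<lambda>j. cmod x \<le> s j" i] i by simp
    have "j \<noteq> 0" using j s(3) False by (metis norm_le_zero_iff)
    then obtain k where k: "j = Suc k" using not0_implies_Suc by blast
    have "s k < cmod x" using not_less_Least[of k "\<lambda>j. cmod x \<le> s j"] k by (simp add: j_def)
    then have "cmod (poly (p j) x) < e k" using n(6)[OF x] j k by simp
    moreover have "cmod (f x - poly (p j) x) \<le> 2 * e j" using j by (intro f_near) simp
    moreover have "e j \<le> 1 / 4" "e k \<le> 1 / 4" by (simp_all add: e_def power_le_one)
    ultimately show ?thesis using norm_triangle_ineq[of "f x - poly (p j) x" "poly (p j) x"] by simp
  qed
  ultimately show ?thesis by blast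
qed

end

section \<open>Composition with a holomorphic function on the left\<close>

lemma abel_universal_not_constant:
  assumes "f \<in> abel_universal \<rho>" "range \<rho> \<subseteq> {0..<1}"
  shows "\<not> f constant_on ball 0 1"
proof
  assume "f constant_on ball 0 1"
  then obtain c where c: "\<And>z. z \<in> ball 0 1 \<Longrightarrow> f z = c" unfolding constant_on_def by blast
  have "- 1 \<in> sphere (0::complex) 1" "- 1 \<notin> {1 :: complex}" by auto
  then have "{1} \<noteq> sphere (0::complex) 1" by blast
  then have "\<exists>n\<ge>0. \<forall>\<zeta>\<in>{1}. cmod (f (complex_of_real (\<rho> n) * \<zeta>) - (c + 1)) < 1"
    using assms(1) by (intro abel_universalD) auto
  then obtain n where "cmod (f (complex_of_real (\<rho> n) * 1) - (c + 1)) < 1" by blast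
  moreover have "complex_of_real (\<rho> n) * 1 \<in> ball 0 1"
  proof -
    have "\<rho> n \<in> {0..<1}" using assms(2) by blast
    then show ?thesis by auto
  qed
  ultimately show False using c by simp
qed

lemma open_abel_universal_image:
  assumes "f \<in> abel_universal \<rho>" "range \<rho> \<subseteq> {0..<1}"
  shows "open (f ` ball 0 1)"
proof (rule open_mapping_thm)
  show "f holomorphic_on ball 0 1" using assms(1) by (simp add: abel_universal_def)
  show "\<not> f constant_on ball 0 1" using assms by (rule abel_universal_not_constant)
qed auto

text \<open>More than uniform continuity on \<open>A\<close>, as \<open>y\<close> may lie outside
  \<open>A\<close>: \<open>d\<close> is a Lebesgue number for a cover of \<open>A\<close> by open
  sets on which \<open>g\<close> oscillates little. It is needed because \<open>f\<close> only comes
  close to a prescribed curve.\<close>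

lemma continuous_near_compact:
  fixes g :: "'a::metric_space \<Rightarrow> 'b::metric_space"
  assumes g: "continuous_on S g" and "open S" and A: "compact A" "A \<subseteq> S" and "e > 0"
  obtains d where "d > 0" "\<And>x y. x \<in> A \<Longrightarrow> dist y x < d \<Longrightarrow> dist (g y) (g x) < e"
proof -
  define \<G> where "\<G> = {G. open G \<and> (\<forall>u\<in>G. \<forall>v\<in>G. dist (g u) (g v) < e)}"
  have "A \<subseteq> \<Union>\<G>"
  proof
    fix x assume "x \<in> A"
    define G where "G = S \<inter> g -` ball (g x) (e / 2)"
    have "open G" unfolding G_def
      using continuous_open_preimage[OF g \<open>open S\<close> open_ball] .
    moreover have "dist (g u) (g v) < e" if "u \<in> G" "v \<in> G" for u v
      using that dist_triangle2[of "g u" "g v" "g x"] by (auto simp: G_def dist_commute)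
    ultimately have "G \<in> \<G>" by (auto simp: \<G>_def)
    moreover have "x \<in> G" using \<open>x \<in> A\<close> A \<open>e > 0\<close> by (auto simp: G_def)
    ultimately show "x \<in> \<Union>\<G>" by blast
  qed
  then obtain d where d: "d > 0" "\<And>x. x \<in> A \<Longrightarrow> \<exists>G\<in>\<G>. ball x d \<subseteq> G"
    by (rule Heine_Borel_lemma[OF A(1)]) (auto simp: \<G>_def)
  have "dist (g y) (g x) < e" if xy: "x \<in> A" "dist y x < d" for x y
  proof -
    obtain G where "G \<in> \<G>" "ball x d \<subseteq> G" using d(2)[OF xy(1)] by blast
    moreover have "x \<in> ball x d" "y \<in> ball x d" using d(1) xy(2) by (auto simp: dist_commute)
    ultimately show ?thesis unfolding \<G>_def by blast
  qed
  then show ?thesis using d(1) that by blast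
qed

text \<open>
  If \<open>g - b\<close> were bounded away from \<open>0\<close> on the component \<open>U\<close>, then \<open>1 / (g - b)\<close> would be
  bounded on \<open>U\<close>, by \<open>1 / R\<close> near the boundary, and larger at \<open>w0\<close> than at some other point \<open>c\<close>
  of \<open>U\<close>. Along suitable circles \<open>\<bar>z\<bar> = \<rho> n\<close> the function \<open>f\<close> is close to \<open>c\<close> off a short arc
  about \<open>1\<close>, on which the factor \<open>(1 - z) / 2\<close> is small. The maximum principle, applied to a high
  power of \<open>1 / (g \<circ> f - b)\<close> times this factor on \<open>{z. \<bar>z\<bar> < \<rho> n, f z \<in> U}\<close>, gives a contradiction.
\<close>
lemma universal_image_iversen:
  fixes \<rho> :: "nat \<Rightarrow> real"
  assumes \<rho>: "range \<rho> \<subseteq> {0..<1}" "\<rho> \<longlonglongrightarrow> 1"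
    and f: "f \<in> abel_universal \<rho>"
    and g: "g holomorphic_on f ` ball 0 1" "\<not> g constant_on (f ` ball 0 1)"
    and w0: "w0 \<in> f ` ball 0 1" "cmod (g w0 - b) < R" and "\<delta> > 0"
  defines "U \<equiv> connected_component_set {w \<in> f ` ball 0 1. g w \<in> ball b R} w0"
  shows "\<exists>w\<in>U. cmod (g w - b) < \<delta>"
proof (rule ccontr)
  assume "\<not> ?thesis"
  then have away: "\<And>w. w \<in> U \<Longrightarrow> \<delta> \<le> cmod (g w - b)" by force
  define \<Omega> where "\<Omega> = f ` ball 0 1"
  define W where "W = {w \<in> \<Omega>. g w \<in> ball b R}"
  have U_def': "U = connected_component_set W w0" by (simp add: U_def W_def \<Omega>_def)
  have hf: "f holomorphic_on ball 0 1" using f by (simp add: abel_universal_def)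
  then have cf: "continuous_on (ball 0 1) f" by (rule holomorphic_on_imp_continuous_on)
  have \<Omega>: "open \<Omega>" "connected \<Omega>"
    unfolding \<Omega>_def using open_abel_universal_image[OF f \<rho>(1)] connected_continuous_image[OF cf] by auto
  have g': "g holomorphic_on \<Omega>" "\<not> g constant_on \<Omega>" using g by (auto simp: \<Omega>_def)
  have cg: "continuous_on \<Omega> g" using g'(1) by (rule holomorphic_on_imp_continuous_on)
  have W: "open W"
    using continuous_open_preimage[OF cg \<Omega>(1), of "ball b R"] by (simp add: W_def vimage_def Int_def)
  then have U: "open U" unfolding U_def' by (rule open_connected_component)
  have w0U: "w0 \<in> U" using w0
    by (auto simp: U_def' W_def \<Omega>_def dist_norm norm_minus_commute intro: connected_component_refl)
  have UW: "U \<subseteq> W" unfolding U_def' by (rule connected_component_subset)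
  define m where "m = cmod (g w0 - b)"
  have m: "m \<ge> \<delta>" "m > 0" using away[OF w0U] \<open>\<delta> > 0\<close> by (auto simp: m_def)
  \<comment> \<open>Otherwise |g - b| would attain its maximum over the open set \<open>U\<close> at
    \<open>w0\<close>, and \<open>g\<close> would be constant on \<open>\<Omega>\<close>.\<close>
  obtain c where c: "c \<in> U" "m < cmod (g c - b)"
  proof (rule ccontr)
    assume "\<not> thesis"
    then have "\<And>c. c \<in> U \<Longrightarrow> cmod (g c - b) \<le> cmod (g w0 - b)" using that by (force simp: m_def)
    then have "(\<lambda>w. g w - b) constant_on \<Omega>"
      using UW \<Omega> U w0U g'(1)
      by (intro maximum_modulus_principle[where U = U and \<xi> = w0])
        (auto simp: W_def intro!: holomorphic_intros)
    then show False using g'(2) unfolding constant_on_def by (metis diff_add_cancel)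
  qed
  \<comment> \<open>\<open>\<mu>\<close> lies above \<open>m\<close> but below both
    \<open>R\<close>, the bound from below where \<open>f z\<close> leaves \<open>U\<close>, and |g
    - b| at \<open>c\<close>, the bound on most of the circle; so one constant serves for both parts
    of the frontier.\<close>
  define \<mu> where "\<mu> = (m + min R (cmod (g c - b))) / 2"
  have \<mu>: "m < \<mu>" "\<mu> < R" "\<mu> < cmod (g c - b)" using c(2) w0(2) by (auto simp: \<mu>_def m_def min_def)
  have "\<mu> > 0" using m \<mu> by simp
  have c\<Omega>: "c \<in> \<Omega>" using c UW by (auto simp: W_def)
  have "continuous (at c) (\<lambda>w. cmod (g w - b))"
    using cg \<Omega>(1) c\<Omega> by (intro continuous_intros) (simp add: continuous_on_eq_continuous_at)
  then have "\<forall>\<^sub>F w in at c. \<mu> < cmod (g w - b)"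
    using \<mu>(3) unfolding continuous_at by (rule order_tendstoD)
  then have "\<forall>\<^sub>F w in nhds c. \<mu> < cmod (g w - b)"
    using \<mu>(3) eventually_nhds_conv_at by blast
  moreover have "\<forall>\<^sub>F w in nhds c. w \<in> U" using U c(1) by (rule eventually_nhds_in_open)
  ultimately have "\<forall>\<^sub>F w in nhds c. \<mu> < cmod (g w - b) \<and> w \<in> U" by (rule eventually_conj)
  then obtain t where t: "t > 0" "\<And>w. dist w c < t \<Longrightarrow> \<mu> < cmod (g w - b)"
    unfolding eventually_nhds_metric by blast
  obtain z0 where z0: "z0 \<in> ball 0 1" "f z0 = w0" using w0(1) by auto
  define \<theta> where "\<theta> = cmod ((1 - z0) / 2)"
  have "\<theta> > 0" using z0 by (auto simp: \<theta>_def)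
  have "m / \<mu> < 1" "0 \<le> m / \<mu>" using \<mu> m by auto
  \<comment> \<open>With this power the ratio \<open>m / \<mu> < 1\<close> outweighs the loss
    \<open>\<theta>\<close> that the factor \<open>(1 - z) / 2\<close> causes at
    \<open>z0\<close>.\<close>
  then obtain N where N: "(m / \<mu>) ^ N < \<theta>" using real_arch_pow_inv[of \<theta> "m / \<mu>"] \<open>\<theta> > 0\<close> by auto
  \<comment> \<open>On the short arc only \<open>1 / \<delta> ^ N\<close> bounds the quotient; a
    factor of size \<open>\<kappa>\<close> brings this down to \<open>1 / \<mu> ^ N\<close>. As the
    arc lies on the circle of radius \<open>\<rho> n\<close>, the choice
    \<open>1 - \<kappa> < \<rho> n\<close> is also needed: it gives |1 - z| < 2 *
    \<open>\<kappa>\<close> there.\<close>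
  define \<kappa> where "\<kappa> = (\<delta> / \<mu>) ^ N"
  have \<kappa>: "\<kappa> > 0" using \<open>\<delta> > 0\<close> \<open>\<mu> > 0\<close> by (simp add: \<kappa>_def)
  have \<kappa>': "\<kappa> / \<delta> ^ N = 1 / \<mu> ^ N" using \<open>\<delta> > 0\<close> by (simp add: \<kappa>_def power_divide)
  define K where "K = sphere 0 1 - ball (1::complex) \<kappa>"
  have "\<forall>\<^sub>F n in sequentially. max (cmod z0) (1 - \<kappa>) < \<rho> n"
    using \<rho>(2) z0(1) \<kappa> by (intro order_tendstoD) auto
  then obtain M where M: "\<And>n. n \<ge> M \<Longrightarrow> max (cmod z0) (1 - \<kappa>) < \<rho> n"
    unfolding eventually_sequentially by blast
  have K: "compact K" "K \<subseteq> sphere 0 1" "K \<noteq> sphere 0 1"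
  proof -
    have "1 \<in> sphere (0::complex) 1" "1 \<notin> K" using \<kappa> by (auto simp: K_def)
    then show "K \<noteq> sphere 0 1" by blast
  qed (auto simp: K_def compact_diff)
  obtain n where n: "n \<ge> M" "\<And>\<zeta>. \<zeta> \<in> K \<Longrightarrow> cmod (f (complex_of_real (\<rho> n) * \<zeta>) - c) < t"
    using abel_universalD[OF f K continuous_on_const t(1), of M c] by blast
  define r where "r = \<rho> n"
  have "r \<in> {0..<1}" unfolding r_def using \<rho>(1) by blast
  then have r: "cmod z0 < r" "1 - \<kappa> < r" "r < 1" "0 < r"
    using M[OF n(1)] norm_ge_zero[of z0] unfolding r_def by (auto simp del: norm_ge_zero)
  define V where "V = {z \<in> ball 0 r. f z \<in> U}"
  have ballr: "ball 0 r \<subseteq> ball (0::complex) 1" "cball 0 r \<subseteq> ball (0::complex) 1" using r by auto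
  have V: "open V"
    using continuous_open_preimage[OF continuous_on_subset[OF cf ballr(1)] open_ball U]
    by (simp add: V_def vimage_def Int_def)
  have clV: "closure V \<subseteq> cball 0 r"
  proof -
    have "V \<subseteq> cball 0 r" by (auto simp: V_def)
    then show ?thesis by (rule closure_minimal) simp
  qed
  have cgf: "continuous_on (cball 0 r) (\<lambda>z. g (f z))"
    using ballr by (intro continuous_on_compose2[OF cg] continuous_on_subset[OF cf]) (auto simp: \<Omega>_def)
  have away': "\<delta> \<le> cmod (g (f z) - b)" if "z \<in> closure V" for z
  proof -
    have "continuous_on (closure V) (\<lambda>z. cmod (g (f z) - b))"
      using clV by (intro continuous_intros continuous_on_subset[OF cgf])
    then show ?thesis
      by (rule continuous_ge_on_closure) (use that away in \<open>auto simp: V_def\<close>)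
  qed
  define G where "G = (\<lambda>z. (1 - z) / 2 / (g (f z) - b) ^ N)"
  have nz: "g (f z) - b \<noteq> 0" if "z \<in> closure V" for z
    using away'[OF that] \<open>\<delta> > 0\<close> by auto
  have "cmod (G z0) \<le> 1 / \<mu> ^ N"
  proof (rule maximum_modulus_frontier[where S = V and f = G and \<xi> = z0])
    show "bounded V" by (rule bounded_subset[of "ball 0 r"]) (auto simp: V_def)
    show "z0 \<in> V" using z0 w0U r by (simp add: V_def)
    show "continuous_on (closure V) G" unfolding G_def
      using clV nz by (intro continuous_intros continuous_on_subset[OF cgf]) auto
    have V1: "V \<subseteq> ball 0 1" using ballr(1) by (auto simp: V_def)
    then have "(g \<circ> f) holomorphic_on V"
      using holomorphic_on_subset[OF hf V1] g'(1)
      by (intro holomorphic_on_compose_gen) (auto simp: \<Omega>_def)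
    then have "(\<lambda>z. g (f z)) holomorphic_on V" by (simp add: o_def)
    then show "G holomorphic_on interior V" unfolding G_def interior_open[OF V]
      using nz closure_subset[of V] by (intro holomorphic_intros) auto
    fix z assume z: "z \<in> frontier V"
    then have zcl: "z \<in> closure V" and "z \<notin> V" using V by (auto simp: frontier_def interior_open)
    have zr: "cmod z \<le> r" using zcl clV by auto
    then have z1: "z \<in> ball 0 1" using r by auto
    have fac: "cmod ((1 - z) / 2) \<le> 1"
      using norm_triangle_ineq4[of 1 z] z1 by (simp add: norm_divide)
    have fin1: "cmod (G z) \<le> 1 / \<mu> ^ N" if "\<mu> \<le> cmod (g (f z) - b)"
    proof -
      have "\<mu> ^ N \<le> cmod (g (f z) - b) ^ N" using that \<open>\<mu> > 0\<close> by (intro power_mono) auto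
      then show ?thesis unfolding G_def norm_divide[of "(1 - z) / 2"] norm_power
        using fac \<open>\<mu> > 0\<close> by (intro frac_le) auto
    qed
    show "cmod (G z) \<le> 1 / \<mu> ^ N"
    proof (cases "cmod z = r")
      case True
      define \<zeta> where "\<zeta> = z / of_real r"
      have \<zeta>: "\<zeta> \<in> sphere 0 1" "z = of_real r * \<zeta>" using True r by (auto simp: \<zeta>_def norm_divide)
      show ?thesis
      proof (cases "\<zeta> \<in> K")
        case True
        then have "dist (f z) c < t" using n(2)[of \<zeta>] \<zeta> by (simp add: r_def dist_norm)
        then show ?thesis using t(2) fin1 by force
      next
        case False
        then have "cmod (1 - \<zeta>) < \<kappa>" using \<zeta> by (simp add: K_def dist_norm)
        moreover have "1 - z = of_real (1 - r) + of_real r * (1 - \<zeta>)"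
          by (simp add: \<zeta>(2) algebra_simps)
        then have "cmod (1 - z) \<le> cmod (of_real (1 - r)) + cmod (of_real r * (1 - \<zeta>))"
          by (metis norm_triangle_ineq)
        then have "cmod (1 - z) \<le> (1 - r) + r * cmod (1 - \<zeta>)"
          unfolding norm_mult norm_of_real using r by simp
        moreover have "r * cmod (1 - \<zeta>) \<le> 1 * cmod (1 - \<zeta>)"
          using r by (intro mult_right_mono) auto
        ultimately have "cmod ((1 - z) / 2) \<le> \<kappa>" using r by (simp add: norm_divide)
        moreover have "\<delta> ^ N \<le> cmod (g (f z) - b) ^ N"
          using away'[OF zcl] \<open>\<delta> > 0\<close> by (intro power_mono) auto
        ultimately have "cmod (G z) \<le> \<kappa> / \<delta> ^ N"
          unfolding G_def norm_divide[of "(1 - z) / 2"] norm_power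
          using \<open>\<delta> > 0\<close> \<kappa> by (intro frac_le) auto
        then show ?thesis using \<kappa>' by simp
      qed
    next
      case False
      then have zb: "z \<in> ball 0 r" using zr by simp
      have fz\<Omega>: "f z \<in> \<Omega>" using z1 by (auto simp: \<Omega>_def)
      have fzU: "f z \<notin> U" using \<open>z \<notin> V\<close> zb by (simp add: V_def)
      have "f z \<in> closure U"
      proof -
        have "f ` closure V \<subseteq> closure (f ` V)"
          by (rule continuous_image_closure_subset[OF cf]) (use clV ballr in blast)
        also have "\<dots> \<subseteq> closure U" by (intro closure_mono) (auto simp: V_def)
        finally show ?thesis using zcl by blast
      qed
      \<comment> \<open>Components of the open set \<open>W\<close> are open, so a point of
        \<open>W\<close> in the closure of \<open>U\<close> already belongs to
        \<open>U\<close>.\<close>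
      have "f z \<notin> W"
      proof
        assume fW: "f z \<in> W"
        define U' where "U' = connected_component_set W (f z)"
        have "open U'" unfolding U'_def using W by (rule open_connected_component)
        moreover have "f z \<in> U'" unfolding U'_def using fW by (simp add: connected_component_refl)
        ultimately have "U' \<inter> U \<noteq> {}"
          using \<open>f z \<in> closure U\<close> closure_iff_nhds_not_empty[of "f z" U] by blast
        then have "U' = U" unfolding U'_def U_def' by (metis connected_component_nonoverlap)
        then show False using fzU \<open>f z \<in> U'\<close> by simp
      qed
      then have "R \<le> cmod (g (f z) - b)" using fz\<Omega> by (simp add: W_def dist_norm norm_minus_commute)
      then show ?thesis using \<mu> by (intro fin1) simp
    qed
  qed
  moreover have "cmod (G z0) = \<theta> / m ^ N"
    by (simp add: G_def z0 m_def \<theta>_def norm_divide norm_power)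
  ultimately have "\<theta> / m ^ N \<le> 1 / \<mu> ^ N" by simp
  then have "\<theta> \<le> (m / \<mu>) ^ N"
    using m(2) \<open>\<mu> > 0\<close> by (simp add: field_simps power_divide)
  then show False using N by simp
qed

section \<open>Approximate lifting of paths\<close>

lemma universal_image_step:
  fixes \<rho> :: "nat \<Rightarrow> real"
  assumes \<rho>: "range \<rho> \<subseteq> {0..<1}" "\<rho> \<longlonglongrightarrow> 1"
    and f: "f \<in> abel_universal \<rho>"
    and g: "g holomorphic_on f ` ball 0 1" "\<not> g constant_on (f ` ball 0 1)"
    and w0: "w0 \<in> f ` ball 0 1" "cmod (g w0 - b) < R" and "\<delta> > 0"
  obtains \<gamma> where "path \<gamma>" "pathstart \<gamma> = w0" "path_image \<gamma> \<subseteq> f ` ball 0 1"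
    "\<forall>t\<in>{0..1}. cmod (g (\<gamma> t) - b) < R" "cmod (g (pathfinish \<gamma>) - b) < \<delta>"
proof -
  define \<Omega> where "\<Omega> = f ` ball 0 1"
  define W where "W = {w \<in> \<Omega>. g w \<in> ball b R}"
  obtain w where w: "w \<in> connected_component_set W w0" "cmod (g w - b) < \<delta>"
    using universal_image_iversen[OF assms] unfolding W_def \<Omega>_def by blast
  have hf: "f holomorphic_on ball 0 1" using f by (simp add: abel_universal_def)
  have \<Omega>: "open \<Omega>" unfolding \<Omega>_def using open_abel_universal_image[OF f \<rho>(1)] .
  have cg: "continuous_on \<Omega> g" using g(1) unfolding \<Omega>_def by (rule holomorphic_on_imp_continuous_on)
  have W: "open W"
    using continuous_open_preimage[OF cg \<Omega>, of "ball b R"] by (simp add: W_def vimage_def Int_def)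
  have "path_component_set W w0 = connected_component_set W w0"
    using W by (rule open_path_connected_component_set[symmetric, THEN sym])
  then have "path_component W w0 w" using w(1) by blast
  then obtain \<gamma> where \<gamma>: "path \<gamma>" "path_image \<gamma> \<subseteq> W" "pathstart \<gamma> = w0" "pathfinish \<gamma> = w"
    unfolding path_component_def by blast
  have "\<forall>t\<in>{0..1}. \<gamma> t \<in> W" using \<gamma>(2) by (auto simp: path_image_def)
  then have "\<forall>t\<in>{0..1}. cmod (g (\<gamma> t) - b) < R"
    by (auto simp: W_def dist_norm norm_minus_commute)
  then show ?thesis using \<gamma> w(2) that[of \<gamma>] unfolding W_def \<Omega>_def by blast
qed

text \<open>Errors do not accumulate, because every piece ends within e =
  \<open>\<epsilon> / 3\<close> of its target. On the next piece \<open>\<phi>\<close> moves by less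
  than e, so the lift starts within 2e of the new end value, stays within 2e of it, hence within 3e
  of \<open>\<phi> t\<close>, and ends within e of it again.\<close>

lemma universal_path_lifting:
  fixes \<rho> :: "nat \<Rightarrow> real" and \<phi> :: "real \<Rightarrow> complex"
  assumes \<rho>: "range \<rho> \<subseteq> {0..<1}" "\<rho> \<longlonglongrightarrow> 1"
    and f: "f \<in> abel_universal \<rho>"
    and g: "g holomorphic_on f ` ball 0 1" "\<not> g constant_on (f ` ball 0 1)"
    and \<phi>: "continuous_on {0..1} \<phi>" and "\<epsilon> > 0"
  obtains \<psi> where "continuous_on {0..1} \<psi>" "\<psi> ` {0..1} \<subseteq> f ` ball 0 1"
    "\<forall>t\<in>{0..1}. cmod (g (\<psi> t) - \<phi> t) < \<epsilon>"
proof -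
  define e where "e = \<epsilon> / 3"
  have e: "e > 0" using \<open>\<epsilon> > 0\<close> by (simp add: e_def)
  have "uniformly_continuous_on {0..1} \<phi>" using \<phi> by (rule compact_uniformly_continuous) simp
  then obtain d where d: "d > 0"
    "\<And>s t. s \<in> {0..1} \<Longrightarrow> t \<in> {0..1} \<Longrightarrow> dist s t < d \<Longrightarrow> dist (\<phi> s) (\<phi> t) < e"
    unfolding uniformly_continuous_on_def using e by metis
  obtain N where N: "N > 0" "inverse (real N) < d" using d(1) real_arch_inverse[of d] by auto
  have main: "\<exists>\<psi>. continuous_on {0..real k / N} \<psi> \<and> \<psi> ` {0..real k / N} \<subseteq> f ` ball 0 1 \<and>
      (\<forall>t\<in>{0..real k / N}. cmod (g (\<psi> t) - \<phi> t) < \<epsilon>) \<and> cmod (g (\<psi> (real k / N)) - \<phi> (real k / N)) < e"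
    if "k \<le> N" for k
    using that
  proof (induction k)
    case 0
    \<comment> \<open>Only the endpoint of the first path is kept, so its start \<open>f 0\<close>
      and the size of \<open>R\<close> are arbitrary.\<close>
    define w where "w = f 0"
    have w: "w \<in> f ` ball 0 1" by (auto simp: w_def)
    define R where "R = cmod (g w - \<phi> 0) + 1"
    have R: "cmod (g w - \<phi> 0) < R" by (simp add: R_def)
    obtain \<gamma> where \<gamma>: "path_image \<gamma> \<subseteq> f ` ball 0 1" "cmod (g (pathfinish \<gamma>) - \<phi> 0) < e"
      using universal_image_step[OF \<rho> f g w R e] by blast
    have "pathfinish \<gamma> \<in> f ` ball 0 1" using \<gamma>(1) pathfinish_in_path_image by blast
    then show ?case using \<gamma>(2) e by (intro exI[of _ "\<lambda>_. pathfinish \<gamma>"]) (auto simp: e_def)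
  next
    case (Suc k)
    define a where "a = real k / N"
    define b where "b = real (Suc k) / N"
    have ba: "b - a = inverse (real N)" "0 \<le> a" "b \<le> 1"
      using N Suc.prems by (auto simp: a_def b_def field_simps)
    have "inverse (real N) > 0" using N by simp
    then have ab: "a < b" using ba(1) by linarith
    obtain \<psi> where \<psi>: "continuous_on {0..a} \<psi>" "\<psi> ` {0..a} \<subseteq> f ` ball 0 1"
      "\<forall>t\<in>{0..a}. cmod (g (\<psi> t) - \<phi> t) < \<epsilon>" "cmod (g (\<psi> a) - \<phi> a) < e"
      using Suc unfolding a_def by auto
    have near: "cmod (\<phi> b - \<phi> t) < e" if "t \<in> {a..b}" for t
      using d(2)[of b t] that ba ab N by (auto simp: dist_norm)
    have "cmod (g (\<psi> a) - \<phi> b) < 2 * e"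
      using \<psi>(4) near[of a] ab norm_triangle_ineq4[of "g (\<psi> a) - \<phi> a" "\<phi> b - \<phi> a"] by simp
    moreover have "\<psi> a \<in> f ` ball 0 1" using \<psi>(2) ba by auto
    ultimately obtain \<gamma> where \<gamma>: "path \<gamma>" "pathstart \<gamma> = \<psi> a" "path_image \<gamma> \<subseteq> f ` ball 0 1"
      "\<forall>t\<in>{0..1}. cmod (g (\<gamma> t) - \<phi> b) < 2 * e" "cmod (g (pathfinish \<gamma>) - \<phi> b) < e"
      using universal_image_step[OF \<rho> f g _ _ e] by blast
    define T where "T = (\<lambda>t. (t - a) / (b - a))"
    have T: "T t \<in> {0..1}" if "t \<in> {a..b}" for t using that ab by (auto simp: T_def)
    define \<psi>' where "\<psi>' = (\<lambda>t. if t \<le> a then \<psi> t else \<gamma> (T t))"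
    have "continuous_on ({0..a} \<union> {a..b}) \<psi>'" unfolding \<psi>'_def
    proof (rule continuous_on_cases)
      show "continuous_on {a..b} (\<lambda>t. \<gamma> (T t))"
      proof (rule continuous_on_compose2[where g = \<gamma> and f = T])
        show "continuous_on {0..1} \<gamma>" using \<gamma>(1) by (simp add: path_def)
        show "continuous_on {a..b} T" unfolding T_def using ab by (intro continuous_intros) auto
        show "T ` {a..b} \<subseteq> {0..1}" using T by blast
      qed
      show "\<forall>t. t \<in> {0..a} \<and> \<not> t \<le> a \<or> t \<in> {a..b} \<and> t \<le> a \<longrightarrow> \<psi> t = \<gamma> (T t)"
        using \<gamma>(2) by (auto simp: T_def pathstart_def)
    qed (use \<psi>(1) in auto)
    moreover have "{0..a} \<union> {a..b} = {0..b}" using ba ab by auto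
    ultimately have "continuous_on {0..b} \<psi>'" by simp
    moreover have "\<psi>' t \<in> f ` ball 0 1" if "t \<in> {0..b}" for t
    proof (cases "t \<le> a")
      case True
      then show ?thesis using that \<psi>(2) by (auto simp: \<psi>'_def)
    next
      case False
      then have "\<gamma> (T t) \<in> path_image \<gamma>" using T[of t] that by (simp add: path_image_def)
      then show ?thesis using False \<gamma>(3) by (auto simp: \<psi>'_def)
    qed
    moreover have "cmod (g (\<psi>' t) - \<phi> t) < \<epsilon>" if "t \<in> {0..b}" for t
    proof (cases "t \<le> a")
      case True
      then show ?thesis using that \<psi>(3) by (simp add: \<psi>'_def)
    next
      case False
      then have t: "t \<in> {a..b}" using that by simp
      have "cmod (g (\<gamma> (T t)) - \<phi> b) < 2 * e" using \<gamma>(4) T[OF t] by blast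
      then have "cmod (g (\<gamma> (T t)) - \<phi> t) < 3 * e"
        using near[OF t] norm_triangle_ineq[of "g (\<gamma> (T t)) - \<phi> b" "\<phi> b - \<phi> t"] by simp
      then show ?thesis using False by (simp add: \<psi>'_def e_def)
    qed
    moreover have "cmod (g (\<psi>' b) - \<phi> b) < e"
      using \<gamma>(5) ab by (simp add: \<psi>'_def T_def pathfinish_def)
    ultimately show ?case unfolding b_def[symmetric] by (intro exI[of _ \<psi>']) blast
  qed
  show ?thesis using main[of N] N that by auto
qed

text \<open>Cutting the circle at a point off \<open>K\<close> turns the target into a path.
  Universality of \<open>f\<close> is applied to the approximate lift \<open>h\<close> of this path,
  and \<open>g\<close> carries the approximation back.\<close>

theorem abel_universal_compose_left:
  fixes \<rho> :: "nat \<Rightarrow> real"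
  assumes \<rho>: "range \<rho> \<subseteq> {0..<1}" "\<rho> \<longlonglongrightarrow> 1"
    and f: "f \<in> abel_universal \<rho>"
    and g: "g holomorphic_on f ` ball 0 1" "\<not> g constant_on (f ` ball 0 1)"
  shows "g \<circ> f \<in> abel_universal \<rho>"
proof (rule abel_universalI)
  have hf: "f holomorphic_on ball 0 1" using f by (simp add: abel_universal_def)
  then show "g \<circ> f holomorphic_on ball 0 1" using g(1) by (rule holomorphic_on_compose)
  define \<Omega> where "\<Omega> = f ` ball 0 1"
  have \<Omega>: "open \<Omega>" unfolding \<Omega>_def using open_abel_universal_image[OF f \<rho>(1)] .
  have cg: "continuous_on \<Omega> g" using g(1) unfolding \<Omega>_def by (rule holomorphic_on_imp_continuous_on)
  fix K :: "complex set" and \<phi> :: "complex \<Rightarrow> complex" and e :: real and N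
  assume K: "compact K" "K \<subseteq> sphere 0 1" "K \<noteq> sphere 0 1" and \<phi>: "continuous_on K \<phi>" and "e > 0"
  obtain c where "c \<in> sphere 0 1" "c \<notin> K" using K(2,3) by blast
  then have c: "cmod c = 1" "c \<notin> K" by auto
  have "closedin (top_of_set UNIV) K" using K(1) by (simp add: compact_imp_closed)
  then obtain \<phi>' where \<phi>': "continuous_on UNIV \<phi>'" "\<And>z. z \<in> K \<Longrightarrow> \<phi>' z = \<phi> z"
    using Tietze_unbounded[OF \<phi>] by metis
  have "continuous_on {0..1} (\<lambda>t. \<phi>' (c * exp (\<i> * of_real (2 * pi * t))))"
    by (rule continuous_on_compose2[OF \<phi>'(1)]) (auto intro!: continuous_intros)
  moreover have "e / 2 > 0" using \<open>e > 0\<close> by simp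
  ultimately obtain \<psi> where \<psi>: "continuous_on {0..1} \<psi>" "\<psi> ` {0..1} \<subseteq> \<Omega>"
    "\<forall>t\<in>{0..1}. cmod (g (\<psi> t) - \<phi>' (c * exp (\<i> * of_real (2 * pi * t)))) < e / 2"
    using universal_path_lifting[OF \<rho> f g] unfolding \<Omega>_def by blast
  \<comment> \<open>\<open>T z\<close> is the position of \<open>z\<close> on the circle cut at
    \<open>c\<close>, as a fraction of a full turn; the jump of \<open>Arg2pi\<close> occurs at
    \<open>c\<close>, which is not in \<open>K\<close>.\<close>
  define T where "T = (\<lambda>z. Arg2pi (z / c) / (2 * pi))"
  have T01: "T z \<in> {0..1}" for z
    using Arg2pi_ge_0[of "z / c"] Arg2pi_lt_2pi[of "z / c"] by (auto simp: T_def)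
  have c0: "c \<noteq> 0" using c by auto
  have Tz: "c * exp (\<i> * of_real (2 * pi * T z)) = z" if "z \<in> K" for z
  proof -
    have "cmod (z / c) = 1" using that K(2) c by (auto simp: norm_divide)
    then have "z / c = exp (\<i> * of_real (Arg2pi (z / c)))"
      using Arg2pi_eq[of "z / c"] by simp
    then show ?thesis using c0 by (simp add: T_def field_simps)
  qed
  have contT: "continuous_on K T"
  proof -
    have "z / c \<notin> \<real>\<^sub>\<ge>\<^sub>0" if "z \<in> K" for z
    proof
      assume "z / c \<in> \<real>\<^sub>\<ge>\<^sub>0"
      then obtain x where x: "z / c = of_real x" "x \<ge> 0" by (auto simp: nonneg_Reals_def)
      have "cmod (z / c) = 1" using that K(2) c by (auto simp: norm_divide)
      then have "x = 1" using x by simp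
      then show False using x c that c0 by simp
    qed
    then have "continuous_on ((\<lambda>z. z / c) ` K) Arg2pi"
      by (intro continuous_at_imp_continuous_on ballI continuous_at_Arg2pi) auto
    then have "continuous_on K (\<lambda>z. Arg2pi (z / c))"
      using c0 by (intro continuous_on_compose2[of _ Arg2pi K "\<lambda>z. z / c"] continuous_intros) auto
    then show ?thesis unfolding T_def by (intro continuous_intros) auto
  qed
  define h where "h = (\<lambda>z. \<psi> (T z))"
  have h: "continuous_on K h" unfolding h_def
    using T01 by (intro continuous_on_compose2[OF \<psi>(1) contT]) auto
  have h\<Omega>: "h ` K \<subseteq> \<Omega>" using \<psi>(2) T01 by (auto simp: h_def)
  have hg: "cmod (g (h z) - \<phi> z) < e / 2" if "z \<in> K" for z
    using \<psi>(3) T01[of z] Tz[OF that] \<phi>'(2)[OF that] unfolding h_def by metis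
  have "compact (h ` K)" using h K(1) by (rule compact_continuous_image)
  then obtain d where d: "d > 0" "\<And>x y. x \<in> h ` K \<Longrightarrow> dist y x < d \<Longrightarrow> dist (g y) (g x) < e / 2"
    using continuous_near_compact[OF cg \<Omega> _ h\<Omega> \<open>e / 2 > 0\<close>] by blast
  obtain n where n: "n \<ge> N" "\<And>\<zeta>. \<zeta> \<in> K \<Longrightarrow> cmod (f (complex_of_real (\<rho> n) * \<zeta>) - h \<zeta>) < d"
    using abel_universalD[OF f K h d(1), of N] by blast
  have "cmod ((g \<circ> f) (complex_of_real (\<rho> n) * \<zeta>) - \<phi> \<zeta>) < e" if z: "\<zeta> \<in> K" for \<zeta>
  proof -
    define w where "w = f (complex_of_real (\<rho> n) * \<zeta>)"
    have "dist (g w) (g (h \<zeta>)) < e / 2"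
      using n(2)[OF z] z d(2)[of "h \<zeta>" w] by (simp add: w_def dist_norm)
    then show ?thesis using hg[OF z] norm_triangle_ineq[of "g w - g (h \<zeta>)" "g (h \<zeta>) - \<phi> \<zeta>"]
      by (simp add: w_def dist_norm)
  qed
  then show "\<exists>n\<ge>N. \<forall>\<zeta>\<in>K. cmod ((g \<circ> f) (complex_of_real (\<rho> n) * \<zeta>) - \<phi> \<zeta>) < e"
    using n(1) by blast
qed

section \<open>Functions unimodular on the circle\<close>

lemma uncountable_sphere: "uncountable (sphere (0::complex) 1)"
  by (rule connected_uncountable[where a = 1 and b = "- 1"]) (auto intro: connected_sphere)

lemma radial_tendsto:
  fixes \<Phi> \<Psi> :: "complex \<Rightarrow> complex"
  assumes cont: "continuous_on (cball 0 1) \<Psi>" and ext: "\<And>z. z \<in> ball 0 1 \<Longrightarrow> \<Psi> z = \<Phi> z"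
    and t: "\<And>n. t n \<in> {0..<1}" "t \<longlonglongrightarrow> 1" and \<zeta>: "cmod \<zeta> = 1"
  shows "(\<lambda>n. \<Phi> (complex_of_real (t n) * \<zeta>)) \<longlonglongrightarrow> \<Psi> \<zeta>"
proof -
  have "(\<lambda>n. complex_of_real (t n) * \<zeta>) \<longlonglongrightarrow> complex_of_real 1 * \<zeta>"
    by (intro tendsto_intros t)
  moreover have in1: "complex_of_real (t n) * \<zeta> \<in> ball 0 1" for n
    using t(1)[of n] \<zeta> by (simp add: norm_mult)
  then have "complex_of_real (t n) * \<zeta> \<in> cball 0 1" for n by (meson ball_subset_cball subsetD)
  moreover have "complex_of_real 1 * \<zeta> \<in> cball 0 1" using \<zeta> by simp
  ultimately have "(\<lambda>n. \<Psi> (complex_of_real (t n) * \<zeta>)) \<longlonglongrightarrow> \<Psi> (complex_of_real 1 * \<zeta>)"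
    by (intro continuous_on_tendsto_compose[OF cont]) (auto intro: always_eventually)
  then show ?thesis using ext in1 by simp
qed

text \<open>The maximum principle applies to \<open>U\<close> and to \<open>1 / U\<close>; both
  being bounded by 1, \<open>u\<close> has constant modulus.\<close>

lemma unimodular_boundary_zero_free_constant:
  fixes u U :: "complex \<Rightarrow> complex"
  assumes hol: "u holomorphic_on ball 0 1" and cont: "continuous_on (cball 0 1) U"
    and ext: "\<And>z. z \<in> ball 0 1 \<Longrightarrow> U z = u z" and uni: "\<And>z. cmod z = 1 \<Longrightarrow> cmod (U z) = 1"
    and nz: "\<And>z. z \<in> ball 0 1 \<Longrightarrow> u z \<noteq> 0"
  obtains c where "cmod c = 1" "\<And>z. z \<in> ball 0 1 \<Longrightarrow> u z = c"
proof -
  have U0: "U z \<noteq> 0" if "z \<in> cball 0 1" for z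
    using that nz[of z] ext[of z] uni[of z] by (cases "cmod z = 1") auto
  have holU: "U holomorphic_on ball 0 1"
    using hol by (rule holomorphic_transform) (simp add: ext)
  have le1: "cmod (U z) \<le> 1" if "z \<in> ball 0 1" for z
    using that uni holU cont
    by (intro maximum_modulus_frontier[where S = "ball 0 1" and f = U and \<xi> = z]) auto
  have ge1: "cmod (inverse (U z)) \<le> 1" if "z \<in> ball 0 1" for z
  proof (rule maximum_modulus_frontier[where S = "ball 0 1" and f = "\<lambda>z. inverse (U z)" and \<xi> = z])
    show "(\<lambda>z. inverse (U z)) holomorphic_on interior (ball 0 1)"
      using holU U0 by (auto intro!: holomorphic_intros)
    show "continuous_on (closure (ball 0 1)) (\<lambda>z. inverse (U z))"
      using cont U0 by (auto intro!: continuous_intros)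
  qed (use that uni in \<open>auto simp: norm_inverse\<close>)
  have eq1: "cmod (u z) = 1" if "z \<in> ball 0 1" for z
  proof -
    have "U z \<noteq> 0" using U0 that by simp
    then have "1 \<le> cmod (U z)" using ge1[OF that] unfolding norm_inverse
      by (metis inverse_le_1_iff linorder_not_le zero_less_norm_iff)
    then show ?thesis using le1[OF that] ext[OF that] by simp
  qed
  have "u constant_on ball 0 1"
    using hol eq1 by (intro maximum_modulus_principle[where U = "ball 0 1" and \<xi> = 0]) auto
  then obtain c where c: "\<And>z. z \<in> ball 0 1 \<Longrightarrow> u z = c" unfolding constant_on_def by blast
  then have "cmod c = 1" using eq1[of 0] by simp
  then show ?thesis using c that by blast
qed

text \<open>Dividing by \<open>z ^ d\<close>, where \<open>d\<close> is the order of vanishing at 0,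
  removes the only possible zero without changing the modulus on the unit circle.\<close>

lemma unimodular_boundary_monomial:
  fixes \<Phi> \<Psi> :: "complex \<Rightarrow> complex"
  assumes hol: "\<Phi> holomorphic_on ball 0 1" and cont: "continuous_on (cball 0 1) \<Psi>"
    and ext: "\<And>z. z \<in> ball 0 1 \<Longrightarrow> \<Psi> z = \<Phi> z" and uni: "\<And>z. cmod z = 1 \<Longrightarrow> cmod (\<Psi> z) = 1"
    and nz: "\<And>z. z \<in> ball 0 1 \<Longrightarrow> z \<noteq> 0 \<Longrightarrow> \<Phi> z \<noteq> 0"
  obtains c d where "cmod c = 1" "\<And>z. z \<in> ball 0 1 \<Longrightarrow> \<Phi> z = c * z ^ d"
proof -
  have "\<Phi> (1/2) \<noteq> 0" by (rule nz) auto
  then have ex: "\<exists>w\<in>ball 0 1. \<Phi> w \<noteq> 0" by (intro bexI[of _ "1/2"]) auto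
  define d where "d = nat (zorder \<Phi> 0)"
  define g where "g = zor_poly \<Phi> 0"
  have "0 \<in> ball (0::complex) 1" by simp
  from zorder_exist_zero[OF hol open_ball connected_ball this ex]
  have "\<exists>r>0. cball 0 r \<subseteq> ball (0::complex) 1 \<and> g holomorphic_on cball 0 r \<and>
      (\<forall>w\<in>cball 0 r. \<Phi> w = g w * w ^ d \<and> g w \<noteq> 0)"
    unfolding d_def g_def diff_zero by (rule conjunct2)
  then obtain r where r: "r > 0" "cball 0 r \<subseteq> ball (0::complex) 1" "g holomorphic_on cball 0 r"
    "\<And>w. w \<in> cball 0 r \<Longrightarrow> \<Phi> w = g w * w ^ d \<and> g w \<noteq> 0"
    by blast
  define U where "U = (\<lambda>w. if w = 0 then g 0 else \<Psi> w / w ^ d)"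
  have Ug: "U w = g w" if "w \<in> ball 0 r" for w
  proof (cases "w = 0")
    case False
    have "w \<in> ball 0 1" using that r(2) ball_subset_cball[of 0 r] by blast
    moreover have "\<Phi> w = g w * w ^ d" using that r(4)[of w] by simp
    ultimately show ?thesis using False ext[of w] by (simp add: U_def)
  qed (simp add: U_def)
  have "U holomorphic_on ball 0 r \<union> (ball 0 1 - {0})"
  proof (rule holomorphic_on_Un)
    show "U holomorphic_on ball 0 r"
      by (rule holomorphic_transform[of g]) (use r(3) Ug in \<open>auto intro: holomorphic_on_subset\<close>)
    have "(\<lambda>w. \<Phi> w / w ^ d) holomorphic_on ball 0 1 - {0}"
      using hol by (auto intro!: holomorphic_intros intro: holomorphic_on_subset)
    then show "U holomorphic_on ball 0 1 - {0}"
      by (rule holomorphic_transform) (auto simp: U_def ext)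
  qed auto
  moreover have "ball 0 r \<union> (ball 0 1 - {0}) = ball (0::complex) 1" using r(1,2) by auto
  ultimately have holU: "U holomorphic_on ball 0 1" by simp
  \<comment> \<open>Holomorphy gives continuity at 0, the quotient formula gives it up to the
    circle; both domains are relatively open in the closed disc.\<close>
  have "continuous_on (ball 0 1 \<union> (cball 0 1 - {0})) U"
  proof (rule continuous_on_Un_local_open)
    have eq: "ball 0 1 \<union> (cball 0 1 - {0}) = cball (0::complex) 1" by auto
    show "openin (top_of_set (ball 0 1 \<union> (cball 0 1 - {0}))) (ball (0::complex) 1)"
      unfolding eq openin_open by (intro exI[of _ "ball 0 1"]) auto
    show "openin (top_of_set (ball 0 1 \<union> (cball 0 1 - {0}))) (cball (0::complex) 1 - {0})"
      unfolding eq openin_open by (intro exI[of _ "- {0}"]) auto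
    show "continuous_on (ball 0 1) U" using holU by (rule holomorphic_on_imp_continuous_on)
    have "continuous_on (cball 0 1 - {0}) (\<lambda>w. \<Psi> w / w ^ d)"
      using cont by (auto intro!: continuous_intros intro: continuous_on_subset)
    then show "continuous_on (cball 0 1 - {0}) U"
      by (rule continuous_on_eq) (auto simp: U_def)
  qed
  moreover have "ball 0 1 \<union> (cball 0 1 - {0}) = cball (0::complex) 1" by auto
  ultimately have contU: "continuous_on (cball 0 1) U" by simp
  have U0: "U z \<noteq> 0" if "z \<in> ball 0 1" for z
    using that nz[of z] ext[of z] r(4)[of 0] r(1) by (auto simp: U_def)
  have U1: "cmod (U z) = 1" if "cmod z = 1" for z
    using that uni[of z] by (auto simp: U_def norm_divide norm_power)
  obtain c where c: "cmod c = 1" "\<And>z. z \<in> ball 0 1 \<Longrightarrow> U z = c"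
    using unimodular_boundary_zero_free_constant[OF holU contU refl U1 U0] by blast
  have "\<Phi> z = c * z ^ d" if "z \<in> ball 0 1" for z
  proof (cases "z = 0")
    case True
    then show ?thesis using c(2)[OF that] r(1) r(4)[of 0] by (auto simp: U_def)
  next
    case False
    then show ?thesis using c(2)[OF that] ext[OF that] by (auto simp: U_def field_simps)
  qed
  then show ?thesis using c(1) that by blast
qed

text \<open>
  Reflection in the circle \<open>\<bar>z\<bar> = r\<close>: the function \<open>\<Phi> z * cnj (\<Phi> (r\<^sup>2 / cnj z))\<close> is holomorphic
  on \<open>r\<^sup>2 < \<bar>z\<bar> < 1\<close> and equals \<open>\<bar>\<Phi> z\<bar>\<^sup>2\<close> for \<open>\<bar>z\<bar> = r\<close>, hence is the constant \<open>R\<^sup>2\<close>.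
\<close>
lemma unimodular_boundary_reflect:
  fixes \<Phi> \<Psi> :: "complex \<Rightarrow> complex"
  assumes hol: "\<Phi> holomorphic_on ball 0 1" and cont: "continuous_on (cball 0 1) \<Psi>"
    and ext: "\<And>z. z \<in> ball 0 1 \<Longrightarrow> \<Psi> z = \<Phi> z" and uni: "\<And>z. cmod z = 1 \<Longrightarrow> cmod (\<Psi> z) = 1"
    and r: "0 < r" "r < 1" and inf: "infinite {z. cmod z = r \<and> cmod (\<Phi> z) = R}"
  shows "\<And>z. cmod z = r\<^sup>2 \<Longrightarrow> cmod (\<Phi> z) = R\<^sup>2"
    and "\<And>z. r\<^sup>2 < cmod z \<Longrightarrow> cmod z < 1 \<Longrightarrow> \<Phi> z \<noteq> 0"
proof -
  define S where "S = {z. cmod z = r \<and> cmod (\<Phi> z) = R}"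
  have r2: "0 < r\<^sup>2" "r\<^sup>2 < r" using r by (auto simp: power2_eq_square)
  have "infinite S" "S \<subseteq> sphere 0 r" using inf by (auto simp: S_def)
  then obtain \<xi> where \<xi>: "\<xi> \<in> sphere 0 r" "\<xi> islimpt S"
    using Heine_Borel_imp_Bolzano_Weierstrass[OF compact_sphere] by blast
  \<comment> \<open>For \<open>R = 0\<close> the identity theorem would make \<open>\<Phi>\<close>
    vanish, against its unimodular boundary values.\<close>
  have R0: "R \<noteq> 0"
  proof
    assume "R = 0"
    have zero: "\<Phi> w = 0" if "w \<in> ball 0 1" for w
    proof (rule analytic_continuation[OF hol open_ball connected_ball _ _ \<xi>(2) _ that])
      show "S \<subseteq> ball 0 1" "\<xi> \<in> ball 0 1" using \<xi>(1) r by (auto simp: S_def)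
      show "\<Phi> z = 0" if "z \<in> S" for z using that \<open>R = 0\<close> by (simp add: S_def)
    qed
    have in01: "1 - inverse (real (Suc n)) \<in> {0..<1}" for n by (auto simp: field_simps)
    have "(\<lambda>n. \<Phi> (complex_of_real (1 - inverse (real (Suc n))) * 1)) \<longlonglongrightarrow> \<Psi> 1"
      using tendsto_diff[OF tendsto_const LIMSEQ_inverse_real_of_nat, of 1]
      by (intro radial_tendsto[OF cont ext in01]) simp_all
    moreover have "\<Phi> (complex_of_real (1 - inverse (real (Suc n))) * 1) = 0" for n
    proof (rule zero)
      have "cmod (complex_of_real (1 - inverse (real (Suc n)))) < 1"
        unfolding norm_of_real using in01[of n] by auto
      then show "complex_of_real (1 - inverse (real (Suc n))) * 1 \<in> ball 0 1" by simp
    qed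
    ultimately have "(\<lambda>n::nat. 0) \<longlonglongrightarrow> \<Psi> 1" by simp
    then have "\<Psi> 1 = 0" using LIMSEQ_unique tendsto_const by blast
    then show False using uni[of 1] by simp
  qed
  define A where "A = {z::complex. r\<^sup>2 < cmod z \<and> cmod z < 1}"
  have A: "open A" "connected A"
    using connected_annulus(1)[of "r\<^sup>2" "0::complex" 1]
    by (auto simp: A_def Collect_conj_eq intro!: open_Int open_Collect_less continuous_intros)
  \<comment> \<open>Conjugating inside and outside keeps the second factor holomorphic, and on the
    circle of radius \<open>r\<close> its argument \<open>r\<^sup>2 / z\<close> is
    \<open>cnj z\<close>.\<close>
  define h where "h = (\<lambda>z. \<Phi> z * (cnj \<circ> \<Phi> \<circ> cnj) (of_real (r\<^sup>2) / z))"
  have "cnj \<circ> \<Phi> \<circ> cnj holomorphic_on ball 0 1"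
  proof (rule holomorphic_on_compose_cnj_cnj)
    show "\<Phi> holomorphic_on cnj ` ball 0 1" using hol by (rule holomorphic_on_subset) auto
  qed simp
  moreover have "(\<lambda>z. of_real (r\<^sup>2) / z) holomorphic_on A"
    using r2 by (intro holomorphic_intros) (auto simp: A_def)
  moreover have "(\<lambda>z. of_real (r\<^sup>2) / z) ` A \<subseteq> ball (0::complex) 1"
    using r2 by (auto simp: A_def norm_divide divide_less_eq norm_power)
  ultimately have "(\<lambda>z. (cnj \<circ> \<Phi> \<circ> cnj) (of_real (r\<^sup>2) / z)) holomorphic_on A"
    using holomorphic_on_compose_gen[of "\<lambda>z. of_real (r\<^sup>2) / z" A "cnj \<circ> \<Phi> \<circ> cnj" "ball 0 1"]
    by (simp add: o_def)
  moreover have "\<Phi> holomorphic_on A" using hol by (rule holomorphic_on_subset) (auto simp: A_def)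
  ultimately have "(\<lambda>z. h z - of_real (R\<^sup>2)) holomorphic_on A"
    unfolding h_def by (intro holomorphic_intros)
  then have "h z - of_real (R\<^sup>2) = 0" if "z \<in> A" for z
  proof (rule analytic_continuation[OF _ A _ _ \<xi>(2) _ that])
    show "S \<subseteq> A" "\<xi> \<in> A" using \<xi>(1) r r2 by (auto simp: S_def A_def)
    fix z assume "z \<in> S"
    then have z: "cmod z = r" "cmod (\<Phi> z) = R" "z \<noteq> 0" using r by (auto simp: S_def)
    then have rz: "of_real (r\<^sup>2) / z = cnj z"
      using complex_norm_square[of z] by (simp add: divide_eq_eq mult.commute)
    have "h z = \<Phi> z * cnj (\<Phi> z)" unfolding h_def rz by simp
    also have "\<dots> = of_real (R\<^sup>2)" using complex_norm_square[of "\<Phi> z"] z by simp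
    finally show "h z - of_real (R\<^sup>2) = 0" by simp
  qed
  then have hA: "\<Phi> z * cnj (\<Phi> (of_real (r\<^sup>2) / cnj z)) = of_real (R\<^sup>2)" if "z \<in> A" for z
    using that by (simp add: h_def)
  show "\<Phi> z \<noteq> 0" if "r\<^sup>2 < cmod z" "cmod z < 1" for z
    using hA[of z] that R0 by (auto simp: A_def)
  show "cmod (\<Phi> z) = R\<^sup>2" if z: "cmod z = r\<^sup>2" for z
  proof -
    define \<zeta> where "\<zeta> = z / of_real (r\<^sup>2)"
    have \<zeta>: "cmod \<zeta> = 1" "z = of_real (r\<^sup>2) * \<zeta>"
      using z r2 by (auto simp: \<zeta>_def norm_divide norm_power)
    have \<zeta>c: "1 / cnj \<zeta> = \<zeta>"
      using \<zeta>(1) complex_norm_square[of \<zeta>] by (auto simp: divide_eq_eq)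
    \<comment> \<open>The circle of radius \<open>r\<^sup>2\<close> is the reflection of the unit
      circle and lies outside \<open>A\<close>, so it is reached by a limit:
      \<open>t n * \<zeta>\<close> stays in \<open>A\<close>, and its reflection
      \<open>z / t n\<close> tends to \<open>z\<close>. The factor
      \<open>(1 - r\<^sup>2) / 2\<close> keeps \<open>t n > r\<^sup>2\<close> even for
      \<open>n = 0\<close>.\<close>
    define t where "t = (\<lambda>n. 1 - (1 - r\<^sup>2) / 2 * inverse (real (Suc n)))"
    have t1: "t \<longlonglongrightarrow> 1"
      using tendsto_diff[OF tendsto_const tendsto_mult[OF tendsto_const LIMSEQ_inverse_real_of_nat], of 1 "(1 - r\<^sup>2) / 2"]
      by (simp add: t_def)
    have t: "r\<^sup>2 < t n" "t n < 1" for n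
    proof -
      have i: "0 < inverse (real (Suc n))" "inverse (real (Suc n)) \<le> 1"
        by (auto simp: inverse_le_1_iff)
      have q: "0 < (1 - r\<^sup>2) / 2" using r2 r by simp
      then have "(1 - r\<^sup>2) / 2 * inverse (real (Suc n)) \<le> (1 - r\<^sup>2) / 2"
        using i by (intro mult_left_le) auto
      moreover have "0 < (1 - r\<^sup>2) / 2 * inverse (real (Suc n))" using i q by (intro mult_pos_pos)
      moreover have "t n = 1 - (1 - r\<^sup>2) / 2 * inverse (real (Suc n))" by (simp only: t_def)
      ultimately have "1 - (1 - r\<^sup>2) / 2 \<le> t n" "t n < 1" by simp_all
      then show "r\<^sup>2 < t n" "t n < 1" using q by (simp_all add: field_simps)
    qed
    have in01: "t n \<in> {0..<1}" for n
      using less_trans[OF r2(1) t(1)[of n]] t(2)[of n] by simp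
    have 1: "(\<lambda>n. \<Phi> (complex_of_real (t n) * \<zeta>)) \<longlonglongrightarrow> \<Psi> \<zeta>"
      by (rule radial_tendsto[OF cont ext in01 t1 \<zeta>(1)])
    have z1: "z \<in> ball 0 1" using z r2 r by simp
    then have "isCont \<Phi> z"
      using holomorphic_on_imp_continuous_on[OF hol] by (simp add: continuous_on_eq_continuous_at)
    moreover have "(\<lambda>n. z / of_real (t n)) \<longlonglongrightarrow> z / of_real 1"
      by (intro tendsto_intros t1) auto
    ultimately have 2: "(\<lambda>n. \<Phi> (z / of_real (t n))) \<longlonglongrightarrow> \<Phi> z"
      using isCont_tendsto_compose[of z \<Phi>] by simp
    have "(\<lambda>n. \<Phi> (complex_of_real (t n) * \<zeta>) * cnj (\<Phi> (z / of_real (t n)))) \<longlonglongrightarrow> \<Psi> \<zeta> * cnj (\<Phi> z)"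
      by (intro tendsto_intros 1 2)
    moreover have "\<Phi> (complex_of_real (t n) * \<zeta>) * cnj (\<Phi> (z / of_real (t n))) = of_real (R\<^sup>2)" for n
    proof -
      have "complex_of_real (t n) * \<zeta> \<in> A"
        using t[of n] in01[of n] \<zeta>(1) by (simp add: A_def norm_mult)
      moreover have "of_real (r\<^sup>2) / cnj (complex_of_real (t n) * \<zeta>) = of_real (r\<^sup>2) / of_real (t n) * (1 / cnj \<zeta>)"
        by simp
      moreover have "\<dots> = z / of_real (t n)" unfolding \<zeta>c by (simp add: \<zeta>(2))
      ultimately show ?thesis using hA by metis
    qed
    ultimately have "(\<lambda>n::nat. complex_of_real (R\<^sup>2)) \<longlonglongrightarrow> \<Psi> \<zeta> * cnj (\<Phi> z)" by simp
    then have "\<Psi> \<zeta> * cnj (\<Phi> z) = of_real (R\<^sup>2)" using LIMSEQ_unique tendsto_const by blast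
    then have "cmod (\<Psi> \<zeta> * cnj (\<Phi> z)) = R\<^sup>2" by (simp only: norm_of_real) simp
    then show ?thesis using uni[OF \<zeta>(1)] by (simp add: norm_mult)
  qed
qed

lemma infinite_circle:
  assumes "r > 0"
  shows "infinite {z. cmod z = r}"
proof -
  have "inj_on (\<lambda>z. complex_of_real r * z) (sphere 0 1)" using assms by (auto simp: inj_on_def)
  then have "infinite ((\<lambda>z. complex_of_real r * z) ` sphere 0 1)"
    using uncountable_sphere by (simp add: finite_image_iff uncountable_infinite)
  moreover have "(\<lambda>z. complex_of_real r * z) ` sphere 0 1 \<subseteq> {z. cmod z = r}"
    using assms by (auto simp: norm_mult)
  ultimately show ?thesis using finite_subset by blast
qed

text \<open>Reflection passes from the radius \<open>r\<close> to \<open>r\<^sup>2\<close>, where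
  its hypothesis holds again, now on the whole circle. The zero-free annuli belonging to the radii
  \<open>r ^ (2 ^ k)\<close> exhaust the punctured disc.\<close>

lemma unimodular_boundary_zero_free:
  fixes \<Phi> \<Psi> :: "complex \<Rightarrow> complex"
  assumes hol: "\<Phi> holomorphic_on ball 0 1" and cont: "continuous_on (cball 0 1) \<Psi>"
    and ext: "\<And>z. z \<in> ball 0 1 \<Longrightarrow> \<Psi> z = \<Phi> z" and uni: "\<And>z. cmod z = 1 \<Longrightarrow> cmod (\<Psi> z) = 1"
    and r: "0 < r" "r < 1" and inf: "infinite {z. cmod z = r \<and> cmod (\<Phi> z) = R}"
    and z: "z \<in> ball 0 1" "z \<noteq> 0"
  shows "\<Phi> z \<noteq> 0"
proof -
  have pw: "0 < r ^ (2 ^ k)" "r ^ (2 ^ k) < 1" for k using r by (auto simp: power_less_one_iff)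
  have "\<exists>R. infinite {z. cmod z = r ^ (2 ^ k) \<and> cmod (\<Phi> z) = R}" for k
  proof (induction k)
    case 0
    then show ?case using inf by auto
  next
    case (Suc k)
    then obtain R where R: "infinite {z. cmod z = r ^ (2 ^ k) \<and> cmod (\<Phi> z) = R}" by blast
    have sq: "(r ^ (2 ^ k))\<^sup>2 = r ^ (2 ^ Suc k)" by (simp add: power_mult[symmetric] mult.commute)
    have "{z. cmod z = r ^ (2 ^ Suc k) \<and> cmod (\<Phi> z) = R\<^sup>2} = {z. cmod z = r ^ (2 ^ Suc k)}"
      using unimodular_boundary_reflect(1)[OF hol cont ext uni pw R] unfolding sq by blast
    then have "infinite {z. cmod z = r ^ (2 ^ Suc k) \<and> cmod (\<Phi> z) = R\<^sup>2}"
      using infinite_circle[OF pw(1), of "Suc k"] by simp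
    then show ?case by blast
  qed
  then obtain R' where R': "infinite {z. cmod z = r ^ (2 ^ k) \<and> cmod (\<Phi> z) = R' k}" for k by metis
  obtain k where k: "r ^ k < cmod z" using real_arch_pow_inv[of "cmod z" r] z r by auto
  have "k < 2 ^ k" by (rule less_exp)
  then have "k \<le> 2 ^ k * 2" by linarith
  then have "r ^ (2 ^ k * 2) \<le> r ^ k" using r by (intro power_decreasing) auto
  then have "(r ^ (2 ^ k))\<^sup>2 < cmod z" using k by (simp add: power_mult)
  then show ?thesis using unimodular_boundary_reflect(2)[OF hol cont ext uni pw R'] z by auto
qed

section \<open>Composition with a self-map of the disc\<close>

lemma abel_universal_compose_rotation:
  assumes f: "f \<in> abel_universal \<rho>" and \<rho>: "range \<rho> \<subseteq> {0..<1}" and c: "cmod c = 1"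
    and \<Phi>: "\<And>z. z \<in> ball 0 1 \<Longrightarrow> \<Phi> z = c * z"
  shows "f \<circ> \<Phi> \<in> abel_universal \<rho>"
proof (rule abel_universalI)
  have hf: "f holomorphic_on ball 0 1" using f by (simp add: abel_universal_def)
  have "(f \<circ> (\<lambda>z. c * z)) holomorphic_on ball 0 1"
    using hf c by (intro holomorphic_on_compose_gen[where t = "ball 0 1"] holomorphic_intros)
      (auto simp: norm_mult)
  then show "f \<circ> \<Phi> holomorphic_on ball 0 1"
    by (rule holomorphic_transform) (simp add: \<Phi>)
  fix K :: "complex set" and \<phi> :: "complex \<Rightarrow> complex" and e :: real and N
  assume K: "compact K" "K \<subseteq> sphere 0 1" "K \<noteq> sphere 0 1" and \<phi>: "continuous_on K \<phi>" and "e > 0"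
  have c0: "c \<noteq> 0" using c by auto
  define K' where "K' = (\<lambda>z. c * z) ` K"
  have K': "compact K'" unfolding K'_def by (intro compact_continuous_image K continuous_intros)
  have K's: "K' \<subseteq> sphere 0 1" using K(2) c by (auto simp: K'_def norm_mult)
  have "K' \<noteq> sphere 0 1"
  proof
    assume eq: "K' = sphere 0 1"
    have "z \<in> K" if "z \<in> sphere 0 1" for z
    proof -
      have "c * z \<in> K'" using that c unfolding eq by (simp add: norm_mult)
      then show ?thesis using c0 by (auto simp: K'_def)
    qed
    then show False using K by blast
  qed
  moreover have "continuous_on K' (\<lambda>w. \<phi> (w / c))"
    by (rule continuous_on_compose2[OF \<phi>]) (use c0 in \<open>auto simp: K'_def intro!: continuous_intros\<close>)
  ultimately obtain n where n: "n \<ge> N"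
    "\<forall>w\<in>K'. cmod (f (complex_of_real (\<rho> n) * w) - \<phi> (w / c)) < e"
    using abel_universalD[OF f K' K's _ _ \<open>e > 0\<close>] by blast
  have "cmod ((f \<circ> \<Phi>) (complex_of_real (\<rho> n) * \<zeta>) - \<phi> \<zeta>) < e" if z: "\<zeta> \<in> K" for \<zeta>
  proof -
    have "\<rho> n \<in> {0..<1}" using \<rho> by blast
    then have "complex_of_real (\<rho> n) * \<zeta> \<in> ball 0 1" using z K(2) by (auto simp: norm_mult)
    then have "(f \<circ> \<Phi>) (complex_of_real (\<rho> n) * \<zeta>) = f (complex_of_real (\<rho> n) * (c * \<zeta>))"
      by (simp add: \<Phi> mult.left_commute)
    moreover have "c * \<zeta> \<in> K'" unfolding K'_def using z by (rule imageI)
    ultimately show ?thesis using n(2) c0 by force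
  qed
  then show "\<exists>n\<ge>N. \<forall>\<zeta>\<in>K. cmod ((f \<circ> \<Phi>) (complex_of_real (\<rho> n) * \<zeta>) - \<phi> \<zeta>) < e"
    using n(1) by blast
qed

text \<open>On a finite set every function is continuous, so the values may be prescribed
  freely.\<close>

lemma abel_universal_finite_dense:
  assumes "F \<in> abel_universal \<rho>" "finite K" "K \<subseteq> sphere 0 1" "e > 0"
  shows "\<exists>n\<ge>N. \<forall>\<zeta>\<in>K. cmod (F (complex_of_real (\<rho> n) * \<zeta>) - \<phi> \<zeta>) < e"
proof (rule abel_universalD[OF assms(1)])
  have "infinite (sphere (0::complex) 1)" using uncountable_sphere by (rule uncountable_infinite)
  then show "K \<noteq> sphere 0 1" using assms(2) by blast
qed (use assms in \<open>auto intro: finite_imp_compact continuous_on_finite\<close>)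

lemma abel_universal_compose_power:
  fixes \<Phi> :: "complex \<Rightarrow> complex"
  assumes F: "F \<circ> \<Phi> \<in> abel_universal \<rho>" and \<rho>: "range \<rho> \<subseteq> {0..<1}"
    and \<Phi>: "\<And>z. z \<in> ball 0 1 \<Longrightarrow> \<Phi> z = c * z ^ d" and "d > 0"
  shows "d = 1"
proof (rule ccontr)
  assume "d \<noteq> 1"
  have card: "card {z::complex. z ^ d = 1} = d" using \<open>d > 0\<close> by (rule card_roots_unity_eq)
  have "{z::complex. z ^ d = 1} \<noteq> {1}" using card \<open>d \<noteq> 1\<close> by auto
  moreover have "1 \<in> {z::complex. z ^ d = 1}" by simp
  ultimately obtain \<omega> :: complex where \<omega>: "\<omega> ^ d = 1" "\<omega> \<noteq> 1" by blast
  have n\<omega>: "cmod \<omega> = 1" using power_eq_1_iff[OF \<omega>(1)] \<open>d > 0\<close> by simp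
  \<comment> \<open>The targets 0 and 2 with tolerance 1 cannot both be met by one common value, and
    \<open>F \<circ> \<Phi>\<close> takes the same value at both points.\<close>
  have "\<exists>n\<ge>0. \<forall>\<zeta>\<in>{1, \<omega>}. cmod ((F \<circ> \<Phi>) (complex_of_real (\<rho> n) * \<zeta>) - (if \<zeta> = 1 then 0 else 2)) < 1"
    by (rule abel_universal_finite_dense[OF F]) (use n\<omega> in auto)
  then obtain n where "\<forall>\<zeta>\<in>{1, \<omega>}.
      cmod ((F \<circ> \<Phi>) (complex_of_real (\<rho> n) * \<zeta>) - (if \<zeta> = 1 then 0 else 2)) < 1" by blast
  then have n: "cmod ((F \<circ> \<Phi>) (complex_of_real (\<rho> n))) < 1"
    "cmod ((F \<circ> \<Phi>) (complex_of_real (\<rho> n) * \<omega>) - 2) < 1"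
    using \<omega>(2) by simp_all
  have "\<rho> n \<in> {0..<1}" using \<rho> by blast
  then have "complex_of_real (\<rho> n) \<in> ball 0 1" "complex_of_real (\<rho> n) * \<omega> \<in> ball 0 1"
    using n\<omega> by (auto simp: norm_mult)
  then have "\<Phi> (complex_of_real (\<rho> n) * \<omega>) = \<Phi> (complex_of_real (\<rho> n))"
    using \<omega>(1) by (simp add: \<Phi> power_mult_distrib)
  then have "cmod ((F \<circ> \<Phi>) (complex_of_real (\<rho> n)) - 2) < 1" using n(2) by simp
  then show False
    using n(1) norm_triangle_ineq4[of "(F \<circ> \<Phi>) (complex_of_real (\<rho> n))"
        "(F \<circ> \<Phi>) (complex_of_real (\<rho> n)) - 2"] by simp
qed

text \<open>\<open>\<Psi>\<close> carries the boundary values, since \<open>\<Phi>\<close> as a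
  total function is arbitrary off the open disc.\<close>

locale universality_preserving =
  fixes \<rho> :: "nat \<Rightarrow> real" and \<Phi> \<Psi> :: "complex \<Rightarrow> complex"
  assumes \<rho>: "range \<rho> \<subseteq> {0..<1}" "\<rho> \<longlonglongrightarrow> 1"
    and into: "\<Phi> ` ball 0 1 \<subseteq> ball 0 1" and hol: "\<Phi> holomorphic_on ball 0 1"
    and cont: "continuous_on (cball 0 1) \<Psi>" and ext: "\<And>z. z \<in> ball 0 1 \<Longrightarrow> \<Psi> z = \<Phi> z"
    and preserving: "\<And>f. f \<in> abel_universal \<rho> \<Longrightarrow> f \<circ> \<Phi> \<in> abel_universal \<rho>"
begin

lemma \<rho>01: "\<rho> n \<in> {0..<1}"
  using \<rho>(1) by blast

lemma radial_limit:
  assumes "cmod \<zeta> = 1"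
  shows "(\<lambda>n. \<Phi> (complex_of_real (\<rho> n) * \<zeta>)) \<longlonglongrightarrow> \<Psi> \<zeta>"
  using radial_tendsto[OF cont ext \<rho>01 \<rho>(2) assms] .

lemma radial_in_ball:
  assumes "cmod \<zeta> = 1"
  shows "\<Phi> (complex_of_real (\<rho> n) * \<zeta>) \<in> ball 0 1"
proof -
  have "complex_of_real (\<rho> n) * \<zeta> \<in> ball 0 1" using assms \<rho>01[of n] by (simp add: norm_mult)
  then show ?thesis using into by blast
qed

lemma boundary_unimodular:
  assumes \<zeta>: "cmod \<zeta> = 1"
  shows "cmod (\<Psi> \<zeta>) = 1"
proof (rule ccontr)
  assume ne: "cmod (\<Psi> \<zeta>) \<noteq> 1"
  have "(\<lambda>n. cmod (\<Phi> (complex_of_real (\<rho> n) * \<zeta>))) \<longlonglongrightarrow> cmod (\<Psi> \<zeta>)"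
    by (intro tendsto_intros radial_limit \<zeta>)
  moreover have "\<And>n. cmod (\<Phi> (complex_of_real (\<rho> n) * \<zeta>)) \<le> 1"
    using radial_in_ball[OF \<zeta>] by (simp add: less_imp_le)
  ultimately have "cmod (\<Psi> \<zeta>) \<le> 1" by (meson LIMSEQ_le_const2)
  then have in1: "\<Psi> \<zeta> \<in> ball 0 1" using ne by simp
  obtain f where f: "f \<in> abel_universal \<rho>"
    using abel_universal_controlled[OF \<rho>, of "{}"] by auto
  have "f holomorphic_on ball 0 1" using f by (simp add: abel_universal_def)
  then have "isCont f (\<Psi> \<zeta>)"
    using in1 holomorphic_on_imp_continuous_on continuous_on_eq_continuous_at open_ball by blast
  then have "(\<lambda>n. f (\<Phi> (complex_of_real (\<rho> n) * \<zeta>))) \<longlonglongrightarrow> f (\<Psi> \<zeta>)"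
    using radial_limit[OF \<zeta>] by (rule isCont_tendsto_compose)
  then obtain N where N: "\<And>n. n \<ge> N \<Longrightarrow> cmod (f (\<Phi> (complex_of_real (\<rho> n) * \<zeta>)) - f (\<Psi> \<zeta>)) < 1"
    unfolding LIMSEQ_iff by (meson zero_less_one)
  have "\<exists>n\<ge>N. \<forall>z\<in>{\<zeta>}. cmod ((f \<circ> \<Phi>) (complex_of_real (\<rho> n) * z) - (f (\<Psi> \<zeta>) + 2)) < 1"
    using \<zeta> by (intro abel_universal_finite_dense preserving f) auto
  then obtain n where n: "n \<ge> N"
    "cmod (f (\<Phi> (complex_of_real (\<rho> n) * \<zeta>)) - (f (\<Psi> \<zeta>) + 2)) < 1" by auto
  have "2 = cmod ((f (\<Phi> (complex_of_real (\<rho> n) * \<zeta>)) - f (\<Psi> \<zeta>))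
      - (f (\<Phi> (complex_of_real (\<rho> n) * \<zeta>)) - (f (\<Psi> \<zeta>) + 2)))" by simp
  also have "\<dots> \<le> cmod (f (\<Phi> (complex_of_real (\<rho> n) * \<zeta>)) - f (\<Psi> \<zeta>))
      + cmod (f (\<Phi> (complex_of_real (\<rho> n) * \<zeta>)) - (f (\<Psi> \<zeta>) + 2))" by (rule norm_triangle_ineq4)
  finally show False using N[OF n(1)] n(2) by simp
qed

text \<open>
  Otherwise the points \<open>\<Phi> (\<rho> n \<zeta>)\<close> avoid all the circles \<open>\<bar>z\<bar> = \<rho> m\<close>, and some universal
  function is bounded on them.
\<close>
lemma radius_hit:
  assumes \<zeta>: "cmod \<zeta> = 1"
  shows "\<exists>n\<ge>N. \<exists>m. cmod (\<Phi> (complex_of_real (\<rho> n) * \<zeta>)) = \<rho> m"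
proof (rule ccontr)
  assume "\<not> ?thesis"
  then have avoid: "\<And>n m. n \<ge> N \<Longrightarrow> cmod (\<Phi> (complex_of_real (\<rho> n) * \<zeta>)) \<noteq> \<rho> m" by blast
  define x where "x = (\<lambda>n. \<Phi> (complex_of_real (\<rho> n) * \<zeta>))"
  define X where "X = x ` {N..}"
  have "(\<lambda>n. cmod (x n)) \<longlonglongrightarrow> cmod (\<Psi> \<zeta>)"
    unfolding x_def by (intro tendsto_intros radial_limit \<zeta>)
  then have lim: "(\<lambda>n. cmod (x n)) \<longlonglongrightarrow> 1" using boundary_unimodular[OF \<zeta>] by simp
  have "finite (X \<inter> cball 0 t)" if "t < 1" for t
  proof -
    have "\<forall>\<^sub>F n in sequentially. t < cmod (x n)" using lim that by (rule order_tendstoD)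
    then obtain M where M: "\<And>n. n \<ge> M \<Longrightarrow> t < cmod (x n)" unfolding eventually_sequentially by blast
    have "X \<inter> cball 0 t \<subseteq> x ` {..<M}"
    proof
      fix y assume "y \<in> X \<inter> cball 0 t"
      then obtain n where "y = x n" "cmod (x n) \<le> t" by (auto simp: X_def)
      then have "n < M" using M[of n] by force
      then show "y \<in> x ` {..<M}" using \<open>y = x n\<close> by blast
    qed
    then show ?thesis using finite_subset by blast
  qed
  moreover have "cmod y \<noteq> \<rho> m" if "y \<in> X" for y m using that avoid by (auto simp: X_def x_def)
  moreover have "X \<subseteq> ball 0 1" using radial_in_ball[OF \<zeta>] by (auto simp: X_def x_def)
  ultimately obtain f where f: "f \<in> abel_universal \<rho>" "\<And>y. y \<in> X \<Longrightarrow> cmod (f y) \<le> 1"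
    using abel_universal_controlled[OF \<rho>, of X] by blast
  have "\<exists>n\<ge>N. \<forall>z\<in>{\<zeta>}. cmod ((f \<circ> \<Phi>) (complex_of_real (\<rho> n) * z) - 3) < 1"
    using \<zeta> by (intro abel_universal_finite_dense preserving f) auto
  then obtain n where n: "n \<ge> N" "cmod (f (x n) - 3) < 1" by (auto simp: x_def)
  have "cmod (f (x n)) \<le> 1" using n(1) by (intro f(2)) (auto simp: X_def)
  then show False using n(2) norm_triangle_ineq4[of "f (x n)" "f (x n) - 3"] by simp
qed

lemma infinitely_many_hits:
  obtains r R where "0 < r" "r < 1" "infinite {z. cmod z = r \<and> cmod (\<Phi> z) = R}"
proof -
  have "\<forall>\<^sub>F n in sequentially. 0 < \<rho> n" using \<rho>(2) by (rule order_tendstoD) simp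
  \<comment> \<open>Indices with \<open>\<rho> n = 0\<close> are discarded, because reflection needs
    a circle of positive radius.\<close>
  then obtain N where N: "\<And>n. n \<ge> N \<Longrightarrow> 0 < \<rho> n" unfolding eventually_sequentially by blast
  define E where "E = (\<lambda>(n, m). {\<zeta> \<in> sphere 0 1. cmod (\<Phi> (complex_of_real (\<rho> n) * \<zeta>)) = \<rho> m})"
  have "sphere 0 1 \<subseteq> (\<Union>p\<in>{N..} \<times> UNIV. E p)"
  proof
    fix \<zeta> :: complex assume "\<zeta> \<in> sphere 0 1"
    then show "\<zeta> \<in> (\<Union>p\<in>{N..} \<times> UNIV. E p)" using radius_hit[of \<zeta> N] by (force simp: E_def)
  qed
  then have "uncountable (\<Union>p\<in>{N..} \<times> UNIV. E p)" using uncountable_sphere countable_subset by blast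
  then obtain p where "p \<in> {N..} \<times> UNIV" "uncountable (E p)" by (metis countableI_type countable_UN)
  then obtain n m where nm: "n \<ge> N" "uncountable (E (n, m))" by (cases p) auto
  define r where "r = \<rho> n"
  have r: "0 < r" "r < 1" using N[OF nm(1)] \<rho>01[of n] by (auto simp: r_def)
  have "inj_on (\<lambda>\<zeta>. complex_of_real r * \<zeta>) (E (n, m))" using r by (auto simp: inj_on_def)
  then have "infinite ((\<lambda>\<zeta>. complex_of_real r * \<zeta>) ` E (n, m))"
    using uncountable_infinite[OF nm(2)] by (simp add: finite_image_iff)
  moreover have "(\<lambda>\<zeta>. complex_of_real r * \<zeta>) ` E (n, m) \<subseteq> {z. cmod z = r \<and> cmod (\<Phi> z) = \<rho> m}"
    using r by (auto simp: E_def norm_mult r_def)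
  ultimately have "infinite {z. cmod z = r \<and> cmod (\<Phi> z) = \<rho> m}" using finite_subset by blast
  then show ?thesis using r that by blast
qed

lemma is_rotation:
  obtains c where "cmod c = 1" "\<And>z. z \<in> ball 0 1 \<Longrightarrow> \<Phi> z = c * z"
proof -
  obtain r R where rR: "0 < r" "r < 1" "infinite {z. cmod z = r \<and> cmod (\<Phi> z) = R}"
    by (rule infinitely_many_hits)
  have nz: "\<Phi> z \<noteq> 0" if "z \<in> ball 0 1" "z \<noteq> 0" for z
    using unimodular_boundary_zero_free[OF hol cont ext boundary_unimodular rR that] .
  obtain c d where cd: "cmod c = 1" "\<And>z. z \<in> ball 0 1 \<Longrightarrow> \<Phi> z = c * z ^ d"
    using unimodular_boundary_monomial[OF hol cont ext boundary_unimodular nz] by blast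
  \<comment> \<open>Otherwise \<open>\<Phi>\<close> would be a constant of modulus 1, which is not a
    value in the open disc.\<close>
  have "d \<noteq> 0"
  proof
    assume "d = 0"
    then have "\<Phi> 0 = c" using cd(2)[of 0] by simp
    moreover have "\<Phi> 0 \<in> ball 0 1" using subsetD[OF into imageI, of 0] by simp
    ultimately show False using cd(1) by simp
  qed
  obtain f where "f \<in> abel_universal \<rho>"
    using abel_universal_controlled[OF \<rho>, of "{}"] by auto
  then have "d = 1"
    using abel_universal_compose_power[OF preserving \<rho>(1) cd(2)] \<open>d \<noteq> 0\<close> by blast
  then show ?thesis using cd that by simp
qed

end

theorem mainTheorem1:
  fixes \<rho> :: "nat \<Rightarrow> real"
  assumes "incseq \<rho>"
    and "range \<rho> \<subseteq> {0..<1}"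
    and "\<rho> \<longlonglongrightarrow> 1"
  shows "(\<forall>f \<in> abel_universal \<rho>. \<forall>g :: complex \<Rightarrow> complex.
            g holomorphic_on (f ` ball 0 1) \<longrightarrow> \<not> g constant_on (f ` ball 0 1) \<longrightarrow>
              g \<circ> f \<in> abel_universal \<rho>)
       \<and> (\<forall>\<Phi> :: complex \<Rightarrow> complex.
            \<Phi> ` ball 0 1 \<subseteq> ball 0 1 \<longrightarrow> \<Phi> holomorphic_on ball 0 1 \<longrightarrow>
            (\<exists>\<Psi>. continuous_on (cball 0 1) \<Psi> \<and> (\<forall>z \<in> ball 0 1. \<Psi> z = \<Phi> z)) \<longrightarrow>
              ((\<forall>f \<in> abel_universal \<rho>. f \<circ> \<Phi> \<in> abel_universal \<rho>) \<longleftrightarrow>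
               (\<exists>\<theta> \<in> {0..2 * pi}. \<forall>z \<in> ball 0 1. \<Phi> z = exp (\<i> * complex_of_real \<theta>) * z)))"
proof (intro conjI ballI allI impI iffI)
  fix f g assume "f \<in> abel_universal \<rho>" "g holomorphic_on (f ` ball 0 1)" "\<not> g constant_on (f ` ball 0 1)"
  then show "g \<circ> f \<in> abel_universal \<rho>" by (rule abel_universal_compose_left[OF assms(2,3)])
next
  fix \<Phi> :: "complex \<Rightarrow> complex"
  assume \<Phi>: "\<Phi> ` ball 0 1 \<subseteq> ball 0 1" "\<Phi> holomorphic_on ball 0 1"
    and "\<exists>\<Psi>. continuous_on (cball 0 1) \<Psi> \<and> (\<forall>z \<in> ball 0 1. \<Psi> z = \<Phi> z)"
    and univ: "\<forall>f \<in> abel_universal \<rho>. f \<circ> \<Phi> \<in> abel_universal \<rho>"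
  then obtain \<Psi> where \<Psi>: "continuous_on (cball 0 1) \<Psi>" "\<And>z. z \<in> ball 0 1 \<Longrightarrow> \<Psi> z = \<Phi> z" by blast
  interpret universality_preserving \<rho> \<Phi> \<Psi>
    using assms(2,3) \<Phi> \<Psi> univ by unfold_locales auto
  obtain c where c: "cmod c = 1" "\<And>z. z \<in> ball 0 1 \<Longrightarrow> \<Phi> z = c * z" using is_rotation by blast
  have "c = exp (\<i> * complex_of_real (Arg2pi c))" using Arg2pi_eq[of c] c(1) by simp
  moreover have "Arg2pi c \<in> {0..2 * pi}" using Arg2pi_ge_0[of c] Arg2pi_lt_2pi[of c] by simp
  ultimately show "\<exists>\<theta> \<in> {0..2 * pi}. \<forall>z \<in> ball 0 1. \<Phi> z = exp (\<i> * complex_of_real \<theta>) * z"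
    using c(2) by metis
next
  fix \<Phi> :: "complex \<Rightarrow> complex" and f
  assume "\<exists>\<theta> \<in> {0..2 * pi}. \<forall>z \<in> ball 0 1. \<Phi> z = exp (\<i> * complex_of_real \<theta>) * z"
    and f: "f \<in> abel_universal \<rho>"
  then obtain \<theta> where \<theta>: "\<And>z. z \<in> ball 0 1 \<Longrightarrow> \<Phi> z = exp (\<i> * complex_of_real \<theta>) * z" by blast
  have "cmod (exp (\<i> * complex_of_real \<theta>)) = 1" by simp
  then show "f \<circ> \<Phi> \<in> abel_universal \<rho>"
    by (rule abel_universal_compose_rotation[OF f assms(2) _ \<theta>])
qed

end
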